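(* Assume that each $m_i$ is $\delta_i$-Ahlfors regular and that $\{\mathcal R_{\alpha,i}\}_{\alpha\in J}$ has the $\kappa$-scaling property for each $1\le i\le d$. Let $\mathbf a\in(0,\infty)^d$ and suppose $$m\Big(\limsup_{\alpha\in J,\ \beta_\alpha\to\infty}\Delta(\mathcal R_\alpha,\rho(\beta_\alpha)^{\mathbf a})\Big)=m(X),$$ i.e. $m$-almost every $x\in X$ lies in $\Delta(\mathcal R_\alpha,\rho(\beta_\alpha)^{\mathbf a})$ for infinitely many $\alpha\in J$. Then for every $\mathbf t\in(0,\infty)^d$, $\dim_HW(\mathbf t)\ge s(\mathbf t)$.
   Context: Fix an integer $d\ge1$. For each $1\le i\le d$, $(X_i,|\cdot|_i)$ is a bounded locally compact metric space carrying a Borel probability measure $m_i$. The measure $m_i$ is $\delta_i$-Ahlfors regular ($\delta_i>0$) if there are constants $c,C,r_0>0$ with $c\,r^{\delta_i}\le m_i(B(x,r))\le C\,r^{\delta_i}$ for all $x\in X_i$ and $0<r\le r_0$. Put $X=\prod_{i=1}^dX_i$ with metric $|x-y|=\max_i|x_i-y_i|_i$ and measure $m=\prod_i m_i$; thus a ball in $X$ is $B(x,r)=\prod_iB(x_i,r)$. For $E\subset X_i$ and $\epsilon>0$, $\Delta(E,\epsilon)=\{y\in X_i:\operatorname{dist}(y,E)<\epsilon\}$. $J$ is an infinite countable index set and $\beta:J\to(0,\infty)$, $\alpha\mapsto\beta_\alpha$, satisfies: $\{\alpha:\beta_\alpha<M\}$ is finite for every $M>1$. $\rho:(0,\infty)\to(0,\infty)$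 is non-increasing with $\rho(u)\to0$ as $u\to\infty$. For each $i$, $\{\mathcal R_{\alpha,i}:\alpha\in J\}$ are subsets of $X_i$ and $\mathcal R_\alpha=\prod_i\mathcal R_{\alpha,i}$. For $\mathbf b=(b_1,\dots,b_d)\in(0,\infty)^d$ and $r>0$, $\Delta(\mathcal R_\alpha,r^{\mathbf b})=\prod_{i=1}^d\Delta(\mathcal R_{\alpha,i},r^{b_i})$. $\kappa$-scaling property ($0\le\kappa<1$): there are constants $c_2,c_3>0$ such that for every $\alpha\in J$, every $x_i\in\mathcal R_{\alpha,i}$ and every $0<\epsilon<r$ (with $r$ sufficiently small), $c_2r^{\delta_i\kappa}\epsilon^{\delta_i(1-\kappa)}\le m_i(B(x_i,r)\cap\Delta(\mathcal R_{\alpha,i},\epsilon))\le c_3r^{\delta_i\kappa}\epsilon^{\delta_i(1-\kappa)}$. For $\mathbf t\in[0,\infty)^d$: $W(\mathbf t)=\{x\in X: x\in\Delta(\mathcal R_\alpha,\rho(\beta_\alpha)^{\mathbf a+\mathbf t})\text{ for infinitely many }\alpha\in J\}$. Dimensional number: let $\mathcal A=\{a_i,\ a_i+t_i:1\le i\le d\}$. For $A\in\mathcal A$ let $\mathcal K_1=\{k:a_k\ge A\}$, $\mathcal K_2=\{k:a_k+t_k\le A\}\setminus\mathcal K_1$, $\mathcal K_3=\{1,\dots,d\}\setminus(\mathcal K_1\cup\mathcal K_2)$, and $$s(\mathbf t)=\min_{A\in\mathcal A}\Big\{\sum_{k\in\mathcal K_1}\delta_k+\sum_{k\in\mathcal K_2}\delta_k+\kappa\sum_{k\in\mathcal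 K_3}\delta_k+(1-\kappa)\frac{\sum_{k\in\mathcal K_3}a_k\delta_k-\sum_{k\in\mathcal K_2}t_k\delta_k}{A}\Big\}.$$ *)

theory Defs
  imports "HOL-Analysis.Analysis" "HOL-Probability.Probability"
begin

definition borel_sets_of :: "'a metric \<Rightarrow> 'a set set" where
  "borel_sets_of M = sets (sigma (mspace M) {U. openin (mtopology_of M) U})"

definition ahlfors_regular :: "'a metric \<Rightarrow> 'a measure \<Rightarrow> real \<Rightarrow> bool" where
  "ahlfors_regular M \<mu> \<delta> \<longleftrightarrow>
     (\<exists>c C r0. c > 0 \<and> C > 0 \<and> r0 > 0 \<and>
        (\<forall>x\<in>mspace M. \<forall>r. 0 < r \<and> r \<le> r0 \<longrightarrow>
            c * r powr \<delta> \<le> measure \<mu> (mball_of M x r) \<and>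
            measure \<mu> (mball_of M x r) \<le> C * r powr \<delta>))"

definition nbhd :: "'a metric \<Rightarrow> 'a set \<Rightarrow> real \<Rightarrow> 'a set" where
  "nbhd M E \<epsilon> = {y \<in> mspace M. \<exists>e\<in>E \<inter> mspace M. mdist M y e < \<epsilon>}"

definition kappa_scaling ::
  "'a metric \<Rightarrow> 'a measure \<Rightarrow> real \<Rightarrow> 'j set \<Rightarrow> ('j \<Rightarrow> 'a set) \<Rightarrow> real \<Rightarrow> bool" where
  "kappa_scaling M \<mu> \<delta> J R \<kappa> \<longleftrightarrow>
     (\<exists>c2 c3 r1. c2 > 0 \<and> c3 > 0 \<and> r1 > 0 \<and>
        (\<forall>\<alpha>\<in>J. \<forall>x\<in>R \<alpha>. \<forall>\<epsilon> r. 0 < \<epsilon> \<and> \<epsilon> < r \<and> r \<le> r1 \<longrightarrow>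
            c2 * r powr (\<delta> * \<kappa>) * \<epsilon> powr (\<delta> * (1 - \<kappa>))
              \<le> measure \<mu> (mball_of M x r \<inter> nbhd M (R \<alpha>) \<epsilon>) \<and>
            measure \<mu> (mball_of M x r \<inter> nbhd M (R \<alpha>) \<epsilon>)
              \<le> c3 * r powr (\<delta> * \<kappa>) * \<epsilon> powr (\<delta> * (1 - \<kappa>))))"

definition prod_dist :: "nat \<Rightarrow> (nat \<Rightarrow> 'a metric) \<Rightarrow> (nat \<Rightarrow> 'a) \<Rightarrow> (nat \<Rightarrow> 'a) \<Rightarrow> real" where
  "prod_dist d M x y = Max ((\<lambda>i. mdist (M i) (x i) (y i)) ` {..<d})"

definition hausdorff_measure :: "'b set \<Rightarrow> ('b \<Rightarrow> 'b \<Rightarrow> real) \<Rightarrow> real \<Rightarrow> 'b set \<Rightarrow> ennreal" where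
  "hausdorff_measure S D s E =
     (SUP \<eta>\<in>{0<..}. INF U \<in> {U :: nat \<Rightarrow> 'b set.
                       E \<subseteq> (\<Union>n. U n) \<and>
                       (\<forall>n. U n \<subseteq> S \<and> (\<forall>x\<in>U n. \<forall>y\<in>U n. D x y \<le> \<eta>))}.
        (\<Sum>n. ennreal (if U n = {} then 0 else (SUP x\<in>U n. SUP y\<in>U n. D x y) powr s)))"

(* Hausdorff dimension: inf {s >= 0. H^s(E) = 0} (restricting to s > 0 gives the same value) *)
definition hausdorff_dim :: "'b set \<Rightarrow> ('b \<Rightarrow> 'b \<Rightarrow> real) \<Rightarrow> 'b set \<Rightarrow> ereal" where
  "hausdorff_dim S D E = Inf (ereal ` {s. s > 0 \<and> hausdorff_measure S D s E = 0})"

definition dimnum ::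
  "nat \<Rightarrow> (nat \<Rightarrow> real) \<Rightarrow> real \<Rightarrow> (nat \<Rightarrow> real) \<Rightarrow> (nat \<Rightarrow> real) \<Rightarrow> real" where
  "dimnum d \<delta> \<kappa> a t =
     Min ((\<lambda>A. let K1 = {k\<in>{..<d}. a k \<ge> A};
                   K2 = {k\<in>{..<d}. a k + t k \<le> A} - K1;
                   K3 = {..<d} - (K1 \<union> K2)
               in (\<Sum>k\<in>K1. \<delta> k) + (\<Sum>k\<in>K2. \<delta> k) + \<kappa> * (\<Sum>k\<in>K3. \<delta> k)
                  + (1 - \<kappa>) * ((\<Sum>k\<in>K3. a k * \<delta> k) - (\<Sum>k\<in>K2. t k * \<delta> k)) / A)
          ` ((\<lambda>i. a i) ` {..<d} \<union> (\<lambda>i. a i + t i) ` {..<d}))"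

definition Wset ::
  "nat \<Rightarrow> (nat \<Rightarrow> 'a metric) \<Rightarrow> 'j set \<Rightarrow> ('j \<Rightarrow> nat \<Rightarrow> 'a set) \<Rightarrow> ('j \<Rightarrow> real)
     \<Rightarrow> (real \<Rightarrow> real) \<Rightarrow> (nat \<Rightarrow> real) \<Rightarrow> (nat \<Rightarrow> real) \<Rightarrow> (nat \<Rightarrow> 'a) set" where
  "Wset d M J R \<beta> \<rho> a t =
     {x \<in> PiE {..<d} (\<lambda>i. mspace (M i)).
        infinite {\<alpha>\<in>J. \<forall>i<d. x i \<in> nbhd (M i) (R \<alpha> i) (\<rho> (\<beta> \<alpha>) powr (a i + t i))}}"

end

(* Since the rectangles with sides rho(beta)^(a_i) cover almost everything, a covering argument picks
   finitely many well separated ones whose enlargements still carry almost all of a given mass; move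
   the mass of each into the much thinner set R_alpha + rho(beta)^(a+t) inside it. Separation and the
   kappa-scaling property bound the new mass of a ball of radius r = rho^A by r^(e(A)), where e(A) is
   the expression minimised in the dimensional number, and e is smallest at a breakpoint.
   Iterating gives nested sets shrinking to a subset of W(t), each carrying a mass with
   mass(B(x, r)) <= C r^s for a fixed C. A cover of W(t) by open balls has, by compactness, a finite
   part that covers one of these sets, so the s-dimensional Hausdorff measure of W(t) is positive for
   every s < s(t). No limit measure is needed. *)

theory Submission
  imports Defs
begin

subsection \<open>The dimensional number as a minimum over all scales\<close>

text \<open>The obstacle is that every transfer concentrates the mass: the bound \<open>H\<close> of
  its density against the product measure worsens without control, while the constant in mass(B(x,
  r)) \<le> C * r^s has to survive infinitely many rounds. Strictness of s < s(t) resolves this.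
  Below a radius \<open>rs\<close> that depends on \<open>H\<close>, the exponent s(t) of the
  separation bound exceeds s by enough to absorb every constant. Above \<open>rs\<close> the
  rectangles, chosen only afterwards, are so small that a transfer affects the mass of a ball no
  more than a slight dilation of the ball does. Hence every C' > C is reachable, and all constants
  stay below 2 * C. A second obstacle is that the carriers of the masses are finite unions of open
  boxes, so limits obtained from compactness might leave them; each carrier is therefore placed in
  the previous one with a uniform margin. Finally, the rectangles of one round have unrelated sizes,
  and a ball can be longer than a rectangle in some directions and shorter in others; the 2^d
  patterns are estimated separately.\<close>

text \<open>Contribution of one coordinate to the dimensional number. With u < 1 the size of a
  resonant neighbourhood and r = u^A, the power of r with this exponent bounds, up to a constant,
  u^(a * \<delta>) times the share that a ball of radius r has in a core (a ball of radius u^a cut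
  with a u^(a+t) neighbourhood). The cases are r \<ge> u^a, r \<le> u^(a+t), and the range
  between.\<close>

definition local_exponent :: "real \<Rightarrow> real \<Rightarrow> real \<Rightarrow> real \<Rightarrow> real \<Rightarrow> real" where
  "local_exponent \<delta> \<kappa> a t A =
     (if A \<le> a then \<delta> else if a + t \<le> A then \<delta> - (1 - \<kappa>) * t * \<delta> / A
      else \<kappa> * \<delta> + (1 - \<kappa>) * a * \<delta> / A)"

lemma dimnum_eq_Min_local_exponent:
  "dimnum d \<delta> \<kappa> a t =
     Min ((\<lambda>A. \<Sum>k<d. local_exponent (\<delta> k) \<kappa> (a k) (t k) A)
            ` (a ` {..<d} \<union> (\<lambda>i. a i + t i) ` {..<d}))"
proof -
  have "(let K1 = {k\<in>{..<d}. a k \<ge> A}; K2 = {k\<in>{..<d}. a k + t k \<le> A} - K1;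
            K3 = {..<d} - (K1 \<union> K2)
         in (\<Sum>k\<in>K1. \<delta> k) + (\<Sum>k\<in>K2. \<delta> k) + \<kappa> * (\<Sum>k\<in>K3. \<delta> k)
            + (1 - \<kappa>) * ((\<Sum>k\<in>K3. a k * \<delta> k) - (\<Sum>k\<in>K2. t k * \<delta> k)) / A)
        = (\<Sum>k<d. local_exponent (\<delta> k) \<kappa> (a k) (t k) A)" for A
  proof -
    define K1 K2 K3 where "K1 = {k\<in>{..<d}. a k \<ge> A}"
      and "K2 = {k\<in>{..<d}. a k + t k \<le> A} - K1" and "K3 = {..<d} - (K1 \<union> K2)"
    let ?e = "\<lambda>k. local_exponent (\<delta> k) \<kappa> (a k) (t k) A"
    have fin: "finite K1" "finite K2" "finite K3"
      by (auto simp: K1_def K2_def K3_def)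
    have "{..<d} = K1 \<union> (K2 \<union> K3)" "K1 \<inter> (K2 \<union> K3) = {}" "K2 \<inter> K3 = {}"
      by (auto simp: K1_def K2_def K3_def)
    then have "sum ?e {..<d} = sum ?e K1 + (sum ?e K2 + sum ?e K3)"
      using fin by (simp add: sum.union_disjoint)
    moreover have "sum ?e K1 = sum \<delta> K1"
      by (rule sum.cong) (auto simp: K1_def local_exponent_def)
    moreover have "sum ?e K2 = (\<Sum>k\<in>K2. \<delta> k - (1 - \<kappa>) * (t k * \<delta> k) / A)"
      by (rule sum.cong) (auto simp: K1_def K2_def local_exponent_def)
    moreover have "sum ?e K3 = (\<Sum>k\<in>K3. \<kappa> * \<delta> k + (1 - \<kappa>) * (a k * \<delta> k) / A)"
      by (rule sum.cong) (auto simp: K1_def K2_def K3_def local_exponent_def)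
    ultimately show ?thesis
      unfolding K1_def[symmetric] Let_def K2_def[symmetric] K3_def[symmetric]
      by (simp add: sum.distrib sum_subtractf flip: sum_distrib_left sum_divide_distrib)
        (simp add: algebra_simps diff_divide_distrib add_divide_distrib)
  qed
  then show ?thesis
    unfolding dimnum_def by simp
qed

lemma local_exponent_le:
  assumes "\<delta> > 0" "\<kappa> \<le> 1" "a > 0" "t > 0"
  shows "local_exponent \<delta> \<kappa> a t A \<le> \<delta>"
proof -
  have "(1 - \<kappa>) * a * \<delta> / A \<le> (1 - \<kappa>) * \<delta>" if "A > a"
  proof -
    have "a / A \<le> 1" using that assms by simp
    then have "((1 - \<kappa>) * \<delta>) * (a / A) \<le> ((1 - \<kappa>) * \<delta>) * 1"
      using assms by (intro mult_left_mono) auto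
    then show ?thesis by (simp add: mult_ac)
  qed
  moreover have "(1 - \<kappa>) * t * \<delta> / A \<ge> 0" if "A > a"
    using that assms by auto
  ultimately show ?thesis
    by (auto simp: local_exponent_def algebra_simps)
qed

text \<open>Between consecutive breakpoints every local exponent is affine in \<open>1 / A\<close>, so the minimum
  over all \<open>A > 0\<close> is attained at a breakpoint.\<close>

lemma dimnum_le_sum_local_exponent:
  assumes d: "d \<ge> 1" and A: "A > 0" and \<kappa>: "\<kappa> \<le> 1"
    and pos: "\<And>i. i < d \<Longrightarrow> \<delta> i > 0" "\<And>i. i < d \<Longrightarrow> a i > 0" "\<And>i. i < d \<Longrightarrow> t i > 0"
  shows "dimnum d \<delta> \<kappa> a t \<le> (\<Sum>k<d. local_exponent (\<delta> k) \<kappa> (a k) (t k) A)"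
proof -
  define BP where "BP = a ` {..<d} \<union> (\<lambda>i. a i + t i) ` {..<d}"
  define e where "e = (\<lambda>k. local_exponent (\<delta> k) \<kappa> (a k) (t k))"
  define g where "g = (\<lambda>A. \<Sum>k<d. e k A)"
  have fin: "finite BP" and mem: "\<And>i. i < d \<Longrightarrow> a i \<in> BP" "\<And>i. i < d \<Longrightarrow> a i + t i \<in> BP"
    by (auto simp: BP_def)
  have ne: "BP \<noteq> {}" using mem(1)[of 0] d by auto
  have BP_pos: "x > 0" if "x \<in> BP" for x
    using that pos(2,3) by (fastforce simp: BP_def)
  have le: "dimnum d \<delta> \<kappa> a t \<le> g B" if "B \<in> BP" for B
    unfolding dimnum_eq_Min_local_exponent BP_def[symmetric] g_def e_def
    using fin that by (intro Min_le) auto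
  have "\<exists>B\<in>BP. g B \<le> g A"
  proof -
    define L U where "L = {B\<in>BP. B \<le> A}" and "U = {B\<in>BP. A \<le> B}"
    consider "L = {}" | "U = {}" | "L \<noteq> {}" "U \<noteq> {}" by blast
    then show ?thesis
    proof cases
      \<comment> \<open>Below all breakpoints every coordinate attains its upper bound
        \<open>\<delta> k\<close>, so any breakpoint does.\<close>
      case 1
      then have "a k \<ge> A" if "k < d" for k
        using mem(1)[OF that] by (force simp: L_def)
      then have "e k A = \<delta> k" if "k < d" for k
        using that by (simp add: e_def local_exponent_def)
      then have "g B \<le> g A" for B
        unfolding g_def by (intro sum_mono) (auto simp: e_def intro!: local_exponent_le pos \<kappa>)
      then show ?thesis using ne by blast
    next
      \<comment> \<open>Above all breakpoints every exponent is \<delta> - const / A with const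
        \<ge> 0, which grows with A, so the largest breakpoint does.\<close>
      case 2
      obtain B where B: "B = Max BP" "B \<in> BP" using fin ne by auto
      have BA: "B \<le> A" using 2 B by (force simp: U_def)
      have "e k B \<le> e k A" if "k < d" for k
      proof -
        have "a k + t k \<le> B" using B fin mem(2)[OF that] by simp
        moreover have "(1 - \<kappa>) * t k * \<delta> k / A \<le> (1 - \<kappa>) * t k * \<delta> k / B"
          using BA BP_pos[OF B(2)] pos[OF that] \<kappa> A by (intro divide_left_mono) auto
        ultimately show ?thesis
          using BA pos[OF that] by (simp add: e_def local_exponent_def)
      qed
      then show ?thesis unfolding g_def using B(2) by (intro bexI[of _ B] sum_mono) auto
    next
      case 3
      have finLU: "finite L" "finite U" using fin by (auto simp: L_def U_def)
      obtain l u where l: "l = Max L" "l \<in> L" and u: "u = Min U" "u \<in> U"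
        using 3 finLU by auto
      have lu: "0 < l" "l \<le> A" "A \<le> u" and inBP: "l \<in> BP" "u \<in> BP"
        using l(2) u(2) BP_pos by (auto simp: L_def U_def)
      have gap: "x \<le> l \<or> u \<le> x" if "x \<in> BP" for x
      proof (cases "x \<le> A")
        case True
        then have "x \<in> L" using that by (simp add: L_def)
        then show ?thesis using finLU l by simp
      next
        case False
        then have "x \<in> U" using that by (simp add: U_def)
        then show ?thesis using finLU u by simp
      qed
      have "\<exists>p q. \<forall>x\<in>{l..u}. e k x = p + q / x" if k: "k < d" for k
      proof -
        note p = pos[OF k]
        consider "u \<le> a k" | "a k + t k \<le> l" | "a k \<le> l" "u \<le> a k + t k"
          using gap[OF mem(1)[OF k]] gap[OF mem(2)[OF k]] p by force
        then show ?thesis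
        proof cases
          case 1
          then have "\<forall>x\<in>{l..u}. e k x = \<delta> k + 0 / x"
            by (auto simp: e_def local_exponent_def)
          then show ?thesis by blast
        next
          case 2
          then have "\<forall>x\<in>{l..u}. e k x = \<delta> k + (- ((1 - \<kappa>) * t k * \<delta> k)) / x"
            using p by (auto simp: e_def local_exponent_def)
          then show ?thesis by blast
        next
          case 3
          \<comment> \<open>The three branches agree at a and at a + t, so the middle formula holds
            on the closed interval, although the definition assigns its end points to the other
            branches.\<close>
          have "e k x = \<kappa> * \<delta> k + ((1 - \<kappa>) * a k * \<delta> k) / x" if x: "x \<in> {l..u}" for x
          proof -
            have "x > 0" using x lu by auto
            consider "x = a k" | "x = a k + t k" | "a k < x" "x < a k + t k"
              using x 3 by force
            then show ?thesis
              using p \<open>x > 0\<close>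
              by cases (auto simp: e_def local_exponent_def field_simps)
          qed
          then show ?thesis by blast
        qed
      qed
      then obtain p q where pq: "\<And>k x. k < d \<Longrightarrow> x \<in> {l..u} \<Longrightarrow> e k x = p k + q k / x"
        by metis
      define P Q where "P = (\<Sum>k<d. p k)" and "Q = (\<Sum>k<d. q k)"
      have g: "g x = P + Q / x" if "x \<in> {l..u}" for x
        using pq that by (simp add: g_def P_def Q_def sum.distrib sum_divide_distrib)
      show ?thesis
      proof (cases "Q \<ge> 0")
        case True
        have "Q / u \<le> Q / A" using True A lu by (intro divide_left_mono) auto
        then have "g u \<le> g A" using g[of u] g[of A] lu by simp
        then show ?thesis using inBP by blast
      next
        case False
        have "Q / l \<le> Q / A" using False A lu by (intro divide_left_mono_neg) auto
        then have "g l \<le> g A" using g[of l] g[of A] lu by simp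
        then show ?thesis using inBP by blast
      qed
    qed
  qed
  then show ?thesis using le unfolding g_def e_def by fastforce
qed

text \<open>Every radius is a power of the resonance size: r = q^A with A = ln r / ln q > 0, as both
  numbers lie in (0, 1). This turns the three regimes into those of \<open>local_exponent\<close>
  and the product into r to a sum of exponents that is at least \<open>dimnum\<close>; the
  inequality reverses because r < 1.\<close>

lemma prod_scale_le_powr_dimnum:
  assumes d: "d \<ge> 1" and \<kappa>: "\<kappa> \<le> 1" and q: "0 < q" "q < 1" and r: "0 < r" "r < 1"
    and pos: "\<And>i. i < d \<Longrightarrow> \<delta> i > 0" "\<And>i. i < d \<Longrightarrow> a i > 0" "\<And>i. i < d \<Longrightarrow> t i > 0"
  shows "(\<Prod>i<d. if q powr a i \<le> r then r powr \<delta> i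
            else if r \<le> q powr (a i + t i) then r powr \<delta> i * q powr (- (t i * \<delta> i * (1 - \<kappa>)))
            else q powr (a i * \<delta> i * (1 - \<kappa>)) * r powr (\<delta> i * \<kappa>))
         \<le> r powr dimnum d \<delta> \<kappa> a t"
proof -
  define A where "A = ln r / ln q"
  have lnq: "ln q < 0" "ln r < 0" using q r by auto
  then have A: "A > 0" by (simp add: A_def divide_neg_neg)
  have rq: "r = q powr A" using q r lnq by (simp add: A_def powr_def)
  have qr: "q = r powr (1 / A)" using A q by (simp add: rq powr_powr)
  have ord: "q powr x \<le> q powr y \<longleftrightarrow> y \<le> x" for x y
    using q lnq by (simp add: powr_def)
  have "(if q powr a i \<le> r then r powr \<delta> i
            else if r \<le> q powr (a i + t i) then r powr \<delta> i * q powr (- (t i * \<delta> i * (1 - \<kappa>)))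
            else q powr (a i * \<delta> i * (1 - \<kappa>)) * r powr (\<delta> i * \<kappa>))
       = r powr local_exponent (\<delta> i) \<kappa> (a i) (t i) A" if "i < d" for i
  proof -
    have e: "q powr x = r powr (x / A)" for x using A q by (simp add: rq powr_powr)
    have "q powr a i \<le> r \<longleftrightarrow> A \<le> a i" "r \<le> q powr (a i + t i) \<longleftrightarrow> a i + t i \<le> A"
      unfolding rq ord by auto
    then show ?thesis
      by (simp add: local_exponent_def e flip: powr_add) (simp add: mult_ac add_ac)
  qed
  then have "(\<Prod>i<d. if q powr a i \<le> r then r powr \<delta> i
            else if r \<le> q powr (a i + t i) then r powr \<delta> i * q powr (- (t i * \<delta> i * (1 - \<kappa>)))
            else q powr (a i * \<delta> i * (1 - \<kappa>)) * r powr (\<delta> i * \<kappa>))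
       = (\<Prod>i<d. r powr local_exponent (\<delta> i) \<kappa> (a i) (t i) A)"
    by (intro prod.cong) auto
  also have "\<dots> = r powr (\<Sum>i<d. local_exponent (\<delta> i) \<kappa> (a i) (t i) A)"
    using r by (simp add: powr_sum)
  also have "\<dots> \<le> r powr dimnum d \<delta> \<kappa> a t"
    using dimnum_le_sum_local_exponent[OF d A \<kappa> pos] r by (intro powr_mono') auto
  finally show ?thesis .
qed

subsection \<open>Boxes in the product space\<close>

text \<open>The products are masses of disjoint boxes in the product over \<open>T\<close> alone,
  where finite additivity applies. \<open>T\<close> is general because rectangles are compared once
  in some directions only and once in all of them.\<close>

lemma sum_prod_measure_le_of_disjoint_boxes:
  assumes prob: "\<And>i. prob_space (m i)" and fin: "finite P" "finite T"
    and A: "\<And>p i. p \<in> P \<Longrightarrow> i \<in> T \<Longrightarrow> A p i \<in> sets (m i)" "\<And>p i. p \<in> P \<Longrightarrow> i \<in> T \<Longrightarrow> A p i \<subseteq> B i"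
    and B: "\<And>i. i \<in> T \<Longrightarrow> B i \<in> sets (m i)"
    and disj: "\<And>p p'. p \<in> P \<Longrightarrow> p' \<in> P \<Longrightarrow> p \<noteq> p' \<Longrightarrow> \<exists>i\<in>T. A p i \<inter> A p' i = {}"
  shows "(\<Sum>p\<in>P. \<Prod>i\<in>T. measure (m i) (A p i)) \<le> (\<Prod>i\<in>T. measure (m i) (B i))"
proof -
  interpret finite_product_prob_space m T
    using prob fin(2)
    by (simp add: finite_product_prob_space_def product_prob_space_def product_prob_space_axioms_def
        product_sigma_finite_def finite_product_sigma_finite_def finite_product_sigma_finite_axioms_def
        prob_space_imp_sigma_finite)
  have "(\<Sum>p\<in>P. \<Prod>i\<in>T. measure (m i) (A p i)) = (\<Sum>p\<in>P. measure (PiM T m) (PiE T (A p)))"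
    by (intro sum.cong refl prob_times[symmetric] A)
  also have "\<dots> = measure (PiM T m) (\<Union>p\<in>P. PiE T (A p))"
  proof (rule finite_measure_finite_Union[symmetric])
    show "disjoint_family_on (\<lambda>p. PiE T (A p)) P"
      unfolding disjoint_family_on_def
    proof (intro ballI impI)
      fix p p' assume "p \<in> P" "p' \<in> P" "p \<noteq> p'"
      from disj[OF this] show "PiE T (A p) \<inter> PiE T (A p') = {}"
        by (force simp: PiE_def)
    qed
  qed (use fin A in \<open>auto intro!: sets_PiM_I_finite\<close>)
  also have "\<dots> \<le> measure (PiM T m) (PiE T B)"
    using fin A B by (intro finite_measure_mono sets_PiM_I_finite) (auto simp: PiE_def Pi_def, blast)
  also have "\<dots> = (\<Prod>i\<in>T. measure (m i) (B i))"
    by (intro prob_times B)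
  finally show ?thesis .
qed

lemma mball_of_mono: "r \<le> s \<Longrightarrow> mball_of X x r \<subseteq> mball_of X x s"
  by auto

lemma mdist_self: "x \<in> mspace X \<Longrightarrow> mdist X x x = 0"
  by simp

lemma openin_mball_of: "openin (mtopology_of X) (mball_of X x r)"
  by (simp add: mball_of_def mtopology_of_def Metric_space.openin_mball)

lemma nbhd_eq_UN: "nbhd X E \<epsilon> = (\<Union>e\<in>E \<inter> mspace X. mball_of X e \<epsilon>)"
  by (auto simp: nbhd_def mdist_commute)

lemma openin_nbhd: "openin (mtopology_of X) (nbhd X E \<epsilon>)"
  unfolding nbhd_eq_UN by (intro openin_Union) (auto simp: openin_mball_of)

lemma openin_mtopology_of:
  "openin (mtopology_of X) U \<longleftrightarrow>
     U \<subseteq> mspace X \<and> (\<forall>x\<in>U. \<exists>r>0. mball_of X x r \<subseteq> U)"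
  by (auto simp: mtopology_of_def mball_of_def Metric_space.openin_mtopology)

lemma mball_of_subset_mball_of:
  assumes "y \<in> mspace X" "mdist X x y + r \<le> s"
  shows "mball_of X x r \<subseteq> mball_of X y s"
proof
  fix z assume z: "z \<in> mball_of X x r"
  then have "mdist X y z \<le> mdist X y x + mdist X x z"
    using assms by (intro mdist_triangle) auto
  then show "z \<in> mball_of X y s" using z assms by (auto simp: mdist_commute)
qed

section \<open>Standing assumptions in normalised form\<close>

text \<open>\<open>q \<alpha>\<close> stands for \<rho>(\<beta> \<alpha>), and
  \<open>q_finite\<close> expresses that these sizes tend to 0 along J. One constant
  \<open>K\<close> and one radius \<open>r0\<close> < 1 serve all coordinates and both sides of each
  estimate. Coordinate hypotheses cover all i, not only i < d, which spares side conditions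
  later.\<close>

locale resonant_system =
  fixes d :: nat and M :: "nat \<Rightarrow> 'a metric" and m :: "nat \<Rightarrow> 'a measure"
    and \<delta> :: "nat \<Rightarrow> real" and \<kappa> :: real
    and J :: "'j set" and R :: "'j \<Rightarrow> nat \<Rightarrow> 'a set" and q :: "'j \<Rightarrow> real"
    and a t :: "nat \<Rightarrow> real" and K r0 :: real
  assumes d_pos: "d \<ge> 1" and prob: "\<And>i. prob_space (m i)"
    and space_m: "\<And>i. space (m i) = mspace (M i)"
    and sets_m: "\<And>i. sets (m i) = borel_sets_of (M i)"
    and delta_pos: "\<And>i. \<delta> i > 0" and kappa: "0 \<le> \<kappa>" "\<kappa> < 1"
    and a_pos: "\<And>i. a i > 0" and t_pos: "\<And>i. t i > 0"
    and K_ge: "K \<ge> 1" and r0: "0 < r0" "r0 < 1"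
    and ball_lower: "\<And>i x r. x \<in> mspace (M i) \<Longrightarrow> 0 < r \<Longrightarrow> r \<le> r0 \<Longrightarrow>
      r powr \<delta> i \<le> K * measure (m i) (mball_of (M i) x r)"
    and ball_upper: "\<And>i x r. x \<in> mspace (M i) \<Longrightarrow> 0 < r \<Longrightarrow> r \<le> r0 \<Longrightarrow>
      measure (m i) (mball_of (M i) x r) \<le> K * r powr \<delta> i"
    and R_sub: "\<And>\<alpha> i. \<alpha> \<in> J \<Longrightarrow> R \<alpha> i \<subseteq> mspace (M i)"
    and nbhd_lower: "\<And>i \<alpha> x \<epsilon> r. \<alpha> \<in> J \<Longrightarrow> x \<in> R \<alpha> i \<Longrightarrow> 0 < \<epsilon> \<Longrightarrow> \<epsilon> < r \<Longrightarrow> r \<le> r0 \<Longrightarrow>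
      r powr (\<delta> i * \<kappa>) * \<epsilon> powr (\<delta> i * (1 - \<kappa>))
        \<le> K * measure (m i) (mball_of (M i) x r \<inter> nbhd (M i) (R \<alpha> i) \<epsilon>)"
    and nbhd_upper: "\<And>i \<alpha> x \<epsilon> r. \<alpha> \<in> J \<Longrightarrow> x \<in> R \<alpha> i \<Longrightarrow> 0 < \<epsilon> \<Longrightarrow> \<epsilon> < r \<Longrightarrow> r \<le> r0 \<Longrightarrow>
      measure (m i) (mball_of (M i) x r \<inter> nbhd (M i) (R \<alpha> i) \<epsilon>)
        \<le> K * (r powr (\<delta> i * \<kappa>) * \<epsilon> powr (\<delta> i * (1 - \<kappa>)))"
    and J_countable: "countable J" and J_infinite: "infinite J"
    and q_pos: "\<And>\<alpha>. \<alpha> \<in> J \<Longrightarrow> q \<alpha> > 0"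
    and q_finite: "\<And>\<tau>. \<tau> > 0 \<Longrightarrow> finite {\<alpha>\<in>J. q \<alpha> \<ge> \<tau>}"
    and full: "AE x in PiM {..<d} m.
                 infinite {\<alpha>\<in>J. \<forall>i<d. x i \<in> nbhd (M i) (R \<alpha> i) (q \<alpha> powr a i)}"
begin

sublocale P: finite_product_prob_space m "{..<d}"
  using prob
  by (simp add: finite_product_prob_space_def product_prob_space_def product_prob_space_axioms_def
      product_sigma_finite_def finite_product_sigma_finite_def finite_product_sigma_finite_axioms_def
      prob_space_imp_sigma_finite)

abbreviation "Pm \<equiv> PiM {..<d} m"

definition pball :: "(nat \<Rightarrow> 'a) \<Rightarrow> real \<Rightarrow> (nat \<Rightarrow> 'a) set" where
  "pball x r = PiE {..<d} (\<lambda>i. mball_of (M i) (x i) r)"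

lemma space_Pm: "space Pm = PiE {..<d} (\<lambda>i. mspace (M i))"
  by (simp add: space_PiM space_m)

lemma open_sets: "openin (mtopology_of (M i)) U \<Longrightarrow> U \<in> sets (m i)"
proof -
  have "{U. openin (mtopology_of (M i)) U} \<subseteq> Pow (mspace (M i))"
    using openin_subset[of "mtopology_of (M i)"] by auto
  then show "openin (mtopology_of (M i)) U \<Longrightarrow> U \<in> sets (m i)"
    by (simp add: sets_m borel_sets_of_def)
qed

lemma ball_sets [measurable]: "mball_of (M i) x r \<in> sets (m i)"
  by (intro open_sets openin_mball_of)

lemma nbhd_sets [measurable]: "nbhd (M i) E \<epsilon> \<in> sets (m i)"
  by (intro open_sets openin_nbhd)

lemma pball_sets [measurable]: "pball x r \<in> sets Pm"
  unfolding pball_def by (intro sets_PiM_I_finite) auto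

lemma pball_mono: "r \<le> s \<Longrightarrow> pball x r \<subseteq> pball x s"
  unfolding pball_def by (intro PiE_mono mball_of_mono)

lemma finite_measure_m: "finite_measure (m i)"
  using prob by (simp add: prob_space.finite_measure)

section \<open>Inner approximation with a uniform margin\<close>

text \<open>A quantitative form of openness: up to small measure, the points of \<open>V\<close>
  have balls of one common radius inside \<open>V\<close>. This margin later keeps limit points
  inside. Using it instead of openness in the product keeps all sets in the product
  sigma-algebra.\<close>

definition approx_inside :: "(nat \<Rightarrow> 'a) set \<Rightarrow> bool" where
  "approx_inside V \<longleftrightarrow> V \<in> sets Pm \<and>
     (\<forall>\<epsilon>>0. \<exists>V0\<in>sets Pm. \<exists>\<eta>>0. V0 \<subseteq> V \<and> measure Pm (V - V0) \<le> \<epsilon> \<and> (\<forall>x\<in>V0. pball x \<eta> \<subseteq> V))"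

lemma approx_inside_sets: "approx_inside V \<Longrightarrow> V \<in> sets Pm"
  by (simp add: approx_inside_def)

text \<open>The points whose \<eta>-ball stays in every \<open>U i\<close> form a measurable box.
  Since each \<open>U i\<close> is open, these boxes increase to the whole box as \<eta> decreases
  to 0, and continuity from below applies.\<close>

lemma approx_inside_box:
  assumes U: "\<And>i. i < d \<Longrightarrow> openin (mtopology_of (M i)) (U i)"
  shows "approx_inside (PiE {..<d} U)"
proof -
  define D where "D = (\<lambda>\<eta> i. {y \<in> mspace (M i). mball_of (M i) y \<eta> \<subseteq> U i})"
  have D_sets: "D \<eta> i \<in> sets (m i)" for \<eta> i
  proof -
    \<comment> \<open>The complement of \<open>D \<eta> i\<close> is a union of open balls, hence
      open.\<close>
    have "D \<eta> i = space (m i) - (\<Union>z\<in>mspace (M i) - U i. mball_of (M i) z \<eta>)"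
      by (auto simp: D_def space_m mdist_commute subset_iff)
    moreover have "openin (mtopology_of (M i)) (\<Union>z\<in>mspace (M i) - U i. mball_of (M i) z \<eta>)"
      by (intro openin_Union) (auto simp: openin_mball_of)
    ultimately show ?thesis using open_sets by auto
  qed
  have U_sets: "U i \<in> sets (m i)" if "i < d" for i using U[OF that] open_sets by auto
  have D_U: "D \<eta> i \<subseteq> U i" if "\<eta> > 0" for \<eta> i
  proof
    fix y assume "y \<in> D \<eta> i"
    moreover from this have "y \<in> mball_of (M i) y \<eta>" using that by (simp add: D_def mdist_self)
    ultimately show "y \<in> U i" unfolding D_def by blast
  qed
  define V where "V = PiE {..<d} U"
  define V0 where "V0 n = PiE {..<d} (D (1 / real (Suc n)))" for n
  have V: "V \<in> sets Pm" unfolding V_def using U_sets by (intro sets_PiM_I_finite) auto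
  have V0: "V0 n \<in> sets Pm" for n unfolding V0_def using D_sets by (intro sets_PiM_I_finite) auto
  have D_mono: "D \<eta> i \<subseteq> D \<eta>' i" if "\<eta>' \<le> \<eta>" for \<eta> \<eta>' i
    using mball_of_mono[OF that, of "M i"] unfolding D_def by blast
  have inc: "incseq V0"
    unfolding incseq_def V0_def by (intro allI impI PiE_mono D_mono) (simp add: field_simps)
  have UV: "(\<Union>n. V0 n) = V"
  proof (intro set_eqI iffI)
    fix x assume "x \<in> V"
    then have x: "\<And>i. i < d \<Longrightarrow> x i \<in> U i" "x \<in> extensional {..<d}"
      by (auto simp: V_def PiE_def)
    have "\<exists>n. \<forall>k\<ge>n. x i \<in> D (1 / real (Suc k)) i" if i: "i < d" for i
    proof -
      obtain r where r: "r > 0" "mball_of (M i) (x i) r \<subseteq> U i" and sub: "U i \<subseteq> mspace (M i)"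
        using U[OF i] x(1)[OF i] by (auto simp: openin_mtopology_of)
      obtain n where n: "1 / real (Suc n) < r" using r nat_approx_posE by blast
      have "x i \<in> D (1 / real (Suc n)) i"
        using n r sub x(1)[OF i] mball_of_mono[of "1 / real (Suc n)" r "M i" "x i"]
        by (auto simp: D_def)
      moreover have "D (1 / real (Suc n)) i \<subseteq> D (1 / real (Suc k)) i" if "k \<ge> n" for k
        using that by (intro D_mono) (simp add: field_simps)
      ultimately show ?thesis by blast
    qed
    then obtain n where n: "\<And>i k. i < d \<Longrightarrow> k \<ge> n i \<Longrightarrow> x i \<in> D (1 / real (Suc k)) i"
      by metis
    have "x \<in> V0 (Max (n ` {..<d}))"
      unfolding V0_def using x(2) by (intro PiE_I n) (auto simp: extensional_def)
    then show "x \<in> (\<Union>n. V0 n)" by blast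
  next
    fix x assume "x \<in> (\<Union>n. V0 n)"
    then obtain n where "x \<in> V0 n" by blast
    then show "x \<in> V" unfolding V0_def V_def
      using PiE_mono[of "{..<d}" "D (1 / real (Suc n))" U] D_U[of "1 / real (Suc n)"] by auto
  qed
  have "(\<lambda>n. measure Pm (V0 n)) \<longlonglongrightarrow> measure Pm V"
    using P.finite_Lim_measure_incseq[of V0] V0 inc unfolding UV by auto
  have "\<exists>V0\<in>sets Pm. \<exists>\<eta>>0. V0 \<subseteq> V \<and> measure Pm (V - V0) \<le> \<epsilon> \<and> (\<forall>x\<in>V0. pball x \<eta> \<subseteq> V)"
    if \<epsilon>: "\<epsilon> > 0" for \<epsilon>
  proof -
    have "eventually (\<lambda>n. dist (measure Pm (V0 n)) (measure Pm V) < \<epsilon>) sequentially"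
      using \<open>(\<lambda>n. measure Pm (V0 n)) \<longlonglongrightarrow> measure Pm V\<close> \<epsilon> by (rule tendstoD)
    then obtain n where n: "dist (measure Pm (V0 n)) (measure Pm V) < \<epsilon>"
      by (auto simp: eventually_sequentially)
    have sub: "V0 n \<subseteq> V" using UV by auto
    have "measure Pm (V - V0 n) = measure Pm V - measure Pm (V0 n)"
      using V V0 sub by (intro P.finite_measure_Diff) auto
    then have "measure Pm (V - V0 n) \<le> \<epsilon>" using n by (simp add: dist_real_def)
    moreover have "\<forall>x\<in>V0 n. pball x (1 / real (Suc n)) \<subseteq> V"
      unfolding V0_def V_def pball_def
      by (intro ballI PiE_mono) (auto simp: D_def PiE_iff subset_iff)
    ultimately show ?thesis
      using V0 sub by (intro bexI[of _ "V0 n"] exI[of _ "1 / real (Suc n)"] conjI) simp_all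
  qed
  then show ?thesis using V unfolding approx_inside_def V_def by blast
qed

lemma approx_inside_empty: "approx_inside {}"
  unfolding approx_inside_def by (auto intro!: exI[of _ 1] bexI[of _ "{}"])

lemma approx_inside_Un:
  assumes "approx_inside V" "approx_inside W"
  shows "approx_inside (V \<union> W)"
  unfolding approx_inside_def
proof (intro conjI allI impI)
  show VW: "V \<union> W \<in> sets Pm" using assms by (auto simp: approx_inside_def)
  fix \<epsilon> :: real assume "\<epsilon> > 0"
  then have "\<epsilon> / 2 > 0" by simp
  obtain V0 \<eta> where V0: "V0 \<in> sets Pm" "\<eta> > 0" "V0 \<subseteq> V" "measure Pm (V - V0) \<le> \<epsilon> / 2"
      "\<forall>x\<in>V0. pball x \<eta> \<subseteq> V"
    using assms(1) \<open>\<epsilon> / 2 > 0\<close> unfolding approx_inside_def by blast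
  obtain W0 \<theta> where W0: "W0 \<in> sets Pm" "\<theta> > 0" "W0 \<subseteq> W" "measure Pm (W - W0) \<le> \<epsilon> / 2"
      "\<forall>x\<in>W0. pball x \<theta> \<subseteq> W"
    using assms(2) \<open>\<epsilon> / 2 > 0\<close> unfolding approx_inside_def by blast
  note * = V0 W0
  have sets: "V \<in> sets Pm" "W \<in> sets Pm" using assms by (auto simp: approx_inside_def)
  have "measure Pm ((V \<union> W) - (V0 \<union> W0)) \<le> measure Pm ((V - V0) \<union> (W - W0))"
    using * sets by (intro P.finite_measure_mono) auto
  also have "\<dots> \<le> measure Pm (V - V0) + measure Pm (W - W0)"
    using * sets by (intro measure_Un_le) auto
  finally have "measure Pm ((V \<union> W) - (V0 \<union> W0)) \<le> \<epsilon>" using * by linarith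
  moreover have "pball x (min \<eta> \<theta>) \<subseteq> V \<union> W" if "x \<in> V0 \<union> W0" for x
    using that *(5,10) pball_mono[of "min \<eta> \<theta>" \<eta> x] pball_mono[of "min \<eta> \<theta>" \<theta> x]
    by (meson Un_iff le_supI1 le_supI2 min.cobounded1 min.cobounded2 order_trans)
  ultimately show "\<exists>V0\<in>sets Pm. \<exists>\<eta>>0. V0 \<subseteq> V \<union> W \<and> measure Pm (V \<union> W - V0) \<le> \<epsilon>
      \<and> (\<forall>x\<in>V0. pball x \<eta> \<subseteq> V \<union> W)"
    using *(1-3,6-8)
    by (intro bexI[of _ "V0 \<union> W0"] exI[of _ "min \<eta> \<theta>"] conjI ballI) (simp_all, blast+)
qed

lemma approx_inside_UN:
  assumes "finite P" "\<And>p. p \<in> P \<Longrightarrow> approx_inside (G p)"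
  shows "approx_inside (\<Union>p\<in>P. G p)"
  using assms
proof (induction rule: finite_induct)
  case empty
  show ?case by (simp add: approx_inside_empty)
next
  case (insert p P)
  have "approx_inside (G p)" "approx_inside (\<Union>p\<in>P. G p)"
    using insert.IH insert.prems by simp_all
  then show ?case unfolding UN_insert by (rule approx_inside_Un)
qed

end

subsection \<open>Mass of small balls\<close>

context resonant_system
begin

definition core :: "'j \<Rightarrow> (nat \<Rightarrow> 'a) \<Rightarrow> nat \<Rightarrow> 'a set" where
  "core \<alpha> z i = mball_of (M i) (z i) (q \<alpha> powr a i) \<inter> nbhd (M i) (R \<alpha> i) (q \<alpha> powr (a i + t i))"

text \<open>The bound of \<open>core_ratio_le\<close> without its constant, completed by the regime
  r \<ge> u^a; the cases are those of \<open>local_exponent\<close>, written in r and u instead of A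
  = ln r / ln u.\<close>

definition scale :: "real \<Rightarrow> real \<Rightarrow> nat \<Rightarrow> real" where
  "scale u r i = (if u powr a i \<le> r then r powr \<delta> i
     else if r \<le> u powr (a i + t i) then r powr \<delta> i * u powr (- (t i * \<delta> i * (1 - \<kappa>)))
     else u powr (a i * \<delta> i * (1 - \<kappa>)) * r powr (\<delta> i * \<kappa>))"

text \<open>One \<open>K\<close> comes from an upper and one from a lower regularity bound,
  3^\<delta> from enlarging a radius r to 3 * r. The same value arises for both kinds of directions
  in \<open>small_ball_class\<close>.\<close>

definition coord_const :: "nat \<Rightarrow> real" where
  "coord_const i = K\<^sup>2 * 3 powr \<delta> i"

lemma coord_const_ge: "coord_const i \<ge> 1" "coord_const i \<ge> 0"
proof -
  have "1 * 1 \<le> K\<^sup>2 * 3 powr \<delta> i"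
    using K_ge delta_pos[of i] by (intro mult_mono) (auto simp: one_le_power ge_one_powr_ge_zero)
  then show "coord_const i \<ge> 1" "coord_const i \<ge> 0" by (auto simp: coord_const_def)
qed

lemma core_sets [measurable]: "core \<alpha> z i \<in> sets (m i)"
  unfolding core_def by measurable

lemma openin_core: "openin (mtopology_of (M i)) (core \<alpha> z i)"
  unfolding core_def by (intro openin_Int openin_mball_of openin_nbhd)

text \<open>This is the scaling property for the radii u^a and u^(a+t) with u =
  \<open>q \<alpha>\<close>: the exponent a * \<delta> * \<kappa> + (a + t) * \<delta> * (1 -
  \<kappa>) equals a * \<delta> + t * \<delta> * (1 - \<kappa>).\<close>

lemma measure_core_lower:
  assumes "\<alpha> \<in> J" "z i \<in> R \<alpha> i" "q \<alpha> < 1" "q \<alpha> powr a i \<le> r0"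
  shows "q \<alpha> powr (a i * \<delta> i + t i * \<delta> i * (1 - \<kappa>)) \<le> K * measure (m i) (core \<alpha> z i)"
proof -
  have "q \<alpha> powr (a i + t i) < q \<alpha> powr a i"
    using q_pos[OF assms(1)] assms(3) t_pos[of i] by (intro powr_less_mono') auto
  then have "(q \<alpha> powr a i) powr (\<delta> i * \<kappa>) * (q \<alpha> powr (a i + t i)) powr (\<delta> i * (1 - \<kappa>))
      \<le> K * measure (m i) (core \<alpha> z i)"
    unfolding core_def using assms q_pos[OF assms(1)] by (intro nbhd_lower) auto
  moreover have "(q \<alpha> powr a i) powr (\<delta> i * \<kappa>) * (q \<alpha> powr (a i + t i)) powr (\<delta> i * (1 - \<kappa>))
     = q \<alpha> powr (a i * \<delta> i + t i * \<delta> i * (1 - \<kappa>))"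
    by (simp add: powr_powr flip: powr_add) (simp add: algebra_simps)
  ultimately show ?thesis by simp
qed

lemma measure_core_pos:
  assumes "\<alpha> \<in> J" "z i \<in> R \<alpha> i" "q \<alpha> < 1" "q \<alpha> powr a i \<le> r0"
  shows "measure (m i) (core \<alpha> z i) > 0"
proof -
  have "0 < K * measure (m i) (core \<alpha> z i)"
    by (rule less_le_trans[OF _ measure_core_lower[of \<alpha> z i, OF assms]]) (use q_pos[OF assms(1)] in auto)
  then show ?thesis using K_ge by (simp add: zero_less_mult_iff)
qed

text \<open>The scaling property speaks only of balls centred in the resonant set. If the ball meets
  the neighbourhood, some b in \<open>R \<alpha> i\<close> has distance less than r + e \<le> 2 * r
  from x, and the ball of radius 3 * r about b contains the given one.\<close>

lemma measure_ball_nbhd_upper: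
  assumes x: "x \<in> mspace (M i)" and \<alpha>: "\<alpha> \<in> J" and e: "0 < e" "e \<le> r" and r: "3 * r \<le> r0"
  shows "measure (m i) (mball_of (M i) x r \<inter> nbhd (M i) (R \<alpha> i) e)
      \<le> K * ((3 * r) powr (\<delta> i * \<kappa>) * e powr (\<delta> i * (1 - \<kappa>)))"
proof (cases "mball_of (M i) x r \<inter> nbhd (M i) (R \<alpha> i) e = {}")
  case True
  then show ?thesis using K_ge by simp
next
  case False
  then obtain y b where y: "y \<in> mspace (M i)" "mdist (M i) x y < r"
    and b: "b \<in> R \<alpha> i" "b \<in> mspace (M i)" "mdist (M i) y b < e"
    by (auto simp: nbhd_def)
  have "mdist (M i) x b \<le> mdist (M i) x y + mdist (M i) y b"
    using x y b by (intro mdist_triangle)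
  then have "mball_of (M i) x r \<subseteq> mball_of (M i) b (3 * r)"
    using x y b e by (intro mball_of_subset_mball_of) auto
  then have "measure (m i) (mball_of (M i) x r \<inter> nbhd (M i) (R \<alpha> i) e)
      \<le> measure (m i) (mball_of (M i) b (3 * r) \<inter> nbhd (M i) (R \<alpha> i) e)"
    by (intro finite_measure.finite_measure_mono[OF finite_measure_m]) auto
  also have "\<dots> \<le> K * ((3 * r) powr (\<delta> i * \<kappa>) * e powr (\<delta> i * (1 - \<kappa>)))"
    using \<alpha> b e r by (intro nbhd_upper) auto
  finally show ?thesis .
qed

text \<open>Since u^(a * \<delta>) is the contribution of this direction to the mass of one
  rectangle, the left side is the contribution to the mass that a ball takes from its core. For r
  \<le> u^(a+t) regularity of the ball is the right bound; for larger r the scaling property is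
  sharper. Dividing by the lower bound for the core gives \<open>scale\<close>.\<close>

lemma core_ratio_le:
  assumes x: "x \<in> mspace (M i)" and \<alpha>: "\<alpha> \<in> J" "z i \<in> R \<alpha> i" "q \<alpha> < 1" "q \<alpha> powr a i \<le> r0"
    and r: "0 < r" "3 * r \<le> r0" "r < q \<alpha> powr a i"
  shows "q \<alpha> powr (a i * \<delta> i) * (measure (m i) (mball_of (M i) x r \<inter> core \<alpha> z i) / measure (m i) (core \<alpha> z i))
      \<le> coord_const i * scale (q \<alpha>) r i"
proof -
  define u where "u = q \<alpha>"
  have u: "u > 0" using q_pos \<alpha> by (simp add: u_def)
  define c where "c = measure (m i) (core \<alpha> z i)"
  have c: "c > 0" "u powr (a i * \<delta> i + t i * \<delta> i * (1 - \<kappa>)) \<le> K * c"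
    using measure_core_pos[of \<alpha> z i, OF \<alpha>] measure_core_lower[of \<alpha> z i, OF \<alpha>] by (auto simp: c_def u_def)
  have three: "3 powr (\<delta> i * \<kappa>) \<le> (3::real) powr \<delta> i" "1 \<le> (3::real) powr \<delta> i"
    using kappa delta_pos[of i] by (auto intro!: powr_mono simp: ge_one_powr_ge_zero)
  define b where "b = measure (m i) (mball_of (M i) x r \<inter> core \<alpha> z i)"
  define B where "B = (if r \<le> u powr (a i + t i) then r powr \<delta> i
      else r powr (\<delta> i * \<kappa>) * u powr ((a i + t i) * \<delta> i * (1 - \<kappa>)))"
  have b: "b \<le> K * 3 powr \<delta> i * B"
  proof (cases "r \<le> u powr (a i + t i)")
    case True
    have "b \<le> measure (m i) (mball_of (M i) x r)"
      unfolding b_def by (intro finite_measure.finite_measure_mono[OF finite_measure_m]) auto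
    also have "\<dots> \<le> K * r powr \<delta> i" using x r by (intro ball_upper) auto
    also have "\<dots> \<le> K * 3 powr \<delta> i * r powr \<delta> i"
      using three K_ge by (intro mult_right_mono) auto
    finally show ?thesis using True by (simp add: B_def)
  next
    case False
    have "b \<le> measure (m i) (mball_of (M i) x r \<inter> nbhd (M i) (R \<alpha> i) (u powr (a i + t i)))"
      unfolding b_def core_def u_def
      by (intro finite_measure.finite_measure_mono[OF finite_measure_m]) auto
    also have "\<dots> \<le> K * ((3 * r) powr (\<delta> i * \<kappa>) * (u powr (a i + t i)) powr (\<delta> i * (1 - \<kappa>)))"
      using x \<alpha> r u False by (intro measure_ball_nbhd_upper) auto
    also have "\<dots> = 3 powr (\<delta> i * \<kappa>) * (K * B)"
      using False r by (simp add: B_def powr_mult powr_powr mult_ac)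
    also have "\<dots> \<le> 3 powr \<delta> i * (K * B)"
      using three K_ge by (intro mult_right_mono) (auto simp: B_def)
    finally show ?thesis by (simp add: mult_ac)
  qed
  have B: "B \<ge> 0" by (simp add: B_def)
  have "b / c \<le> (K * 3 powr \<delta> i * B) / (u powr (a i * \<delta> i + t i * \<delta> i * (1 - \<kappa>)) / K)"
    using b c u K_ge B by (intro frac_le) (auto simp: field_simps)
  then have "u powr (a i * \<delta> i) * (b / c)
      \<le> u powr (a i * \<delta> i) * ((K * 3 powr \<delta> i * B) / (u powr (a i * \<delta> i + t i * \<delta> i * (1 - \<kappa>)) / K))"
    by (intro mult_left_mono) auto
  also have "\<dots> = coord_const i * (B * u powr (- (t i * \<delta> i * (1 - \<kappa>))))"
  proof -
    have "u powr (a i * \<delta> i) = u powr (a i * \<delta> i + t i * \<delta> i * (1 - \<kappa>)) * u powr (- (t i * \<delta> i * (1 - \<kappa>)))"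
      by (simp flip: powr_add)
    then show ?thesis using u by (simp add: coord_const_def power2_eq_square)
  qed
  also have "B * u powr (- (t i * \<delta> i * (1 - \<kappa>))) = scale u r i"
    using r by (simp add: B_def scale_def u_def mult.assoc flip: powr_add) (simp add: algebra_simps)
  finally show ?thesis by (simp add: u_def b_def c_def)
qed

definition wide :: "real \<Rightarrow> real \<Rightarrow> nat set" where
  "wide r u = {i\<in>{..<d}. u powr a i \<le> r}"

text \<open>Two disjoint rectangles that meet the same ball of radius \<open>r\<close> and have the same set \<open>T\<close> of
  directions in which they are shorter than \<open>r\<close> overlap in all other directions, so their
  projections to \<open>T\<close> are disjoint. This replaces counting rectangles of comparable size.\<close>

lemma small_ball_class:
  assumes fin: "finite P"
    and P: "\<And>\<alpha> z. (\<alpha>, z) \<in> P \<Longrightarrow> \<alpha> \<in> J \<and> q \<alpha> < 1 \<and> (\<forall>i<d. z i \<in> R \<alpha> i \<and> q \<alpha> powr a i \<le> r0)"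
    and sep: "\<And>\<alpha> z \<alpha>' z'. (\<alpha>, z) \<in> P \<Longrightarrow> (\<alpha>', z') \<in> P \<Longrightarrow> (\<alpha>, z) \<noteq> (\<alpha>', z') \<Longrightarrow>
      \<exists>i<d. 3 * (q \<alpha> powr a i + q \<alpha>' powr a i) \<le> mdist (M i) (z i) (z' i)"
    and T: "\<And>\<alpha> z. (\<alpha>, z) \<in> P \<Longrightarrow> wide r (q \<alpha>) = T" "T \<subseteq> {..<d}"
    and w: "\<And>\<alpha> z. (\<alpha>, z) \<in> P \<Longrightarrow> 0 \<le> w (\<alpha>, z) \<and>
        w (\<alpha>, z) * (\<Prod>i<d. measure (m i) (core \<alpha> z i)) \<le> H * (\<Prod>i<d. q \<alpha> powr (a i * \<delta> i))"
    and H: "H \<ge> 0"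
    and x: "\<And>i. i < d \<Longrightarrow> x i \<in> mspace (M i)"
    and hit: "\<And>\<alpha> z i. (\<alpha>, z) \<in> P \<Longrightarrow> i < d \<Longrightarrow> mball_of (M i) (x i) r \<inter> core \<alpha> z i \<noteq> {}"
    and r: "0 < r" "3 * r \<le> r0"
  shows "(\<Sum>(\<alpha>, z)\<in>P. w (\<alpha>, z) * (\<Prod>i<d. measure (m i) (mball_of (M i) (x i) r \<inter> core \<alpha> z i)))
      \<le> H * (\<Prod>i<d. coord_const i) * r powr dimnum d \<delta> \<kappa> a t"
proof -
  define c where "c = (\<lambda>\<alpha> z i. measure (m i) (core \<alpha> z i))"
  define b where "b = (\<lambda>\<alpha> z i. measure (m i) (mball_of (M i) (x i) r \<inter> core \<alpha> z i))"
  define D where "D = dimnum d \<delta> \<kappa> a t"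
  define side where "side = (\<lambda>\<alpha> z i. measure (m i) (mball_of (M i) (z i) (q \<alpha> powr a i)))"
  have split: "prod f {..<d} = prod f T * prod f ({..<d} - T)" for f :: "nat \<Rightarrow> real"
    using T(2) by (metis finite_lessThan mult.commute prod.subset_diff)
  have bc: "0 \<le> b \<alpha> z i" "b \<alpha> z i \<le> c \<alpha> z i" for \<alpha> z i
    unfolding b_def c_def by (auto intro!: finite_measure.finite_measure_mono[OF finite_measure_m])
  have prod_r: "(\<Prod>i\<in>T. r powr \<delta> i) > 0" using r by (intro prod_pos) auto
  have dist_hit: "mdist (M i) (z i) (x i) < q \<alpha> powr a i + r"
    and z_mem: "z i \<in> mspace (M i)" if hyp: "(\<alpha>, z) \<in> P" "i < d" for \<alpha> z i
  proof -
    obtain y where y: "y \<in> mball_of (M i) (x i) r" "y \<in> mball_of (M i) (z i) (q \<alpha> powr a i)"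
      using hit[OF hyp] unfolding core_def by blast
    then have "mdist (M i) (z i) (x i) \<le> mdist (M i) (z i) y + mdist (M i) y (x i)"
      by (intro mdist_triangle) auto
    then show "mdist (M i) (z i) (x i) < q \<alpha> powr a i + r"
      using y by (auto simp: mdist_commute)
    show "z i \<in> mspace (M i)" using y by auto
  qed
  have wideT: "i \<in> T \<longleftrightarrow> q \<alpha> powr a i \<le> r" if "(\<alpha>, z) \<in> P" "i < d" for \<alpha> z i
    using T(1)[OF that(1)] that(2) by (auto simp: wide_def)
  \<comment> \<open>The part of the bound that does not depend on the rectangle. In the directions
    of \<open>T\<close> the value of \<open>scale\<close> is r^\<delta>; these factors are divided
    out here and return when the sides of the rectangles are summed.\<close>
  define E where "E = H * (\<Prod>i\<in>{..<d} - T. coord_const i) * (\<Prod>i\<in>T. K) * r powr D / (\<Prod>i\<in>T. r powr \<delta> i)"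
  have E: "E \<ge> 0" unfolding E_def using H K_ge prod_r coord_const_ge
    by (intro divide_nonneg_pos mult_nonneg_nonneg prod_nonneg) auto
  have term_le: "w (\<alpha>, z) * (\<Prod>i<d. b \<alpha> z i) \<le> E * (\<Prod>i\<in>T. side \<alpha> z i)" if p: "(\<alpha>, z) \<in> P" for \<alpha> z
  proof -
    have \<alpha>: "\<alpha> \<in> J" "q \<alpha> < 1" "q \<alpha> > 0" and zi: "\<And>i. i < d \<Longrightarrow> z i \<in> R \<alpha> i"
      and le_r0: "\<And>i. i < d \<Longrightarrow> q \<alpha> powr a i \<le> r0"
      using P[OF p] q_pos by auto
    have c_pos: "c \<alpha> z i > 0" if "i < d" for i
      unfolding c_def using \<alpha> zi[OF that] le_r0[OF that] by (intro measure_core_pos) auto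
    have "w (\<alpha>, z) * (\<Prod>i<d. b \<alpha> z i)
        = (w (\<alpha>, z) * (\<Prod>i<d. c \<alpha> z i)) * (\<Prod>i<d. b \<alpha> z i / c \<alpha> z i)"
    proof -
      have "(\<Prod>i<d. b \<alpha> z i) = (\<Prod>i<d. c \<alpha> z i * (b \<alpha> z i / c \<alpha> z i))"
        using c_pos by (intro prod.cong) (auto simp: less_imp_neq[symmetric])
      then show ?thesis by (simp only: prod.distrib mult.assoc)
    qed
    also have "\<dots> \<le> (H * (\<Prod>i<d. q \<alpha> powr (a i * \<delta> i))) * (\<Prod>i<d. b \<alpha> z i / c \<alpha> z i)"
      using w[OF p] bc c_pos
      by (intro mult_right_mono prod_nonneg) (auto simp: c_def intro!: divide_nonneg_pos)
    also have "\<dots> = H * (\<Prod>i<d. q \<alpha> powr (a i * \<delta> i) * (b \<alpha> z i / c \<alpha> z i))"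
      by (simp only: prod.distrib mult.assoc)
    also have "\<dots> = H * ((\<Prod>i\<in>T. q \<alpha> powr (a i * \<delta> i) * (b \<alpha> z i / c \<alpha> z i))
        * (\<Prod>i\<in>{..<d} - T. q \<alpha> powr (a i * \<delta> i) * (b \<alpha> z i / c \<alpha> z i)))"
      by (subst split) (rule refl)
    \<comment> \<open>In a direction of \<open>T\<close> the ball may contain the whole core, so the
      share is bounded by 1 and u^(a * \<delta>) is traded for the measure of the side; in the other
      directions \<open>core_ratio_le\<close> applies.\<close>
    also have "\<dots> \<le> H * ((\<Prod>i\<in>T. K * side \<alpha> z i) * (\<Prod>i\<in>{..<d} - T. coord_const i * scale (q \<alpha>) r i))"
    proof (rule mult_left_mono[OF mult_mono[OF prod_mono prod_mono prod_nonneg prod_nonneg] H],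
        goal_cases)
      case (1 i)
      then have i: "i < d" using T by auto
      have "q \<alpha> powr (a i * \<delta> i) * (b \<alpha> z i / c \<alpha> z i) \<le> q \<alpha> powr (a i * \<delta> i) * 1"
        using bc[of \<alpha> z i] c_pos[OF i] by (intro mult_left_mono) auto
      also have "\<dots> = (q \<alpha> powr a i) powr \<delta> i" by (simp add: powr_powr)
      also have "\<dots> \<le> K * side \<alpha> z i"
        unfolding side_def using z_mem[OF p i] le_r0[OF i] \<alpha> by (intro ball_lower) auto
      finally show ?case
        using bc[of \<alpha> z i] c_pos[OF i] by simp
    next
      case (2 i)
      then have i: "i < d" and "\<not> q \<alpha> powr a i \<le> r" using wideT[OF p] by auto
      then have "q \<alpha> powr (a i * \<delta> i) * (b \<alpha> z i / c \<alpha> z i) \<le> coord_const i * scale (q \<alpha>) r i"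
        unfolding b_def c_def using x zi le_r0 \<alpha> r by (intro core_ratio_le) auto
      then show ?case
        using bc[of \<alpha> z i] c_pos[OF i] by simp
    qed (use bc c_pos T(2) K_ge in \<open>auto simp: side_def intro!: divide_nonneg_nonneg less_imp_le[OF c_pos]\<close>)
    also have "\<dots> = H * (\<Prod>i\<in>T. K) * (\<Prod>i\<in>T. side \<alpha> z i) * (\<Prod>i\<in>{..<d} - T. coord_const i)
        * (\<Prod>i\<in>{..<d} - T. scale (q \<alpha>) r i)"
      by (simp only: prod.distrib mult_ac)
    also have "\<dots> \<le> H * (\<Prod>i\<in>T. K) * (\<Prod>i\<in>T. side \<alpha> z i) * (\<Prod>i\<in>{..<d} - T. coord_const i)
        * (r powr D / (\<Prod>i\<in>T. r powr \<delta> i))"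
    proof (rule mult_left_mono)
      have "(\<Prod>i\<in>T. r powr \<delta> i) * (\<Prod>i\<in>{..<d} - T. scale (q \<alpha>) r i) = (\<Prod>i<d. scale (q \<alpha>) r i)"
      proof -
        have "(\<Prod>i\<in>T. r powr \<delta> i) = (\<Prod>i\<in>T. scale (q \<alpha>) r i)"
          using T(2) wideT[OF p] by (intro prod.cong) (auto simp: scale_def)
        then show ?thesis by (simp only: split)
      qed
      also have "\<dots> \<le> r powr D"
        unfolding scale_def D_def using d_pos kappa \<alpha> r r0 delta_pos a_pos t_pos
        by (intro prod_scale_le_powr_dimnum) auto
      finally show "(\<Prod>i\<in>{..<d} - T. scale (q \<alpha>) r i) \<le> r powr D / (\<Prod>i\<in>T. r powr \<delta> i)"
        using prod_r by (simp add: field_simps)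
    qed (use H K_ge coord_const_ge in \<open>auto intro!: mult_nonneg_nonneg prod_nonneg simp: side_def\<close>)
    finally show ?thesis by (simp add: E_def mult_ac)
  qed
  have "(\<Sum>(\<alpha>, z)\<in>P. \<Prod>i\<in>T. side \<alpha> z i) \<le> (\<Prod>i\<in>T. measure (m i) (mball_of (M i) (x i) (3 * r)))"
  proof -
    have "(\<Sum>p\<in>P. \<Prod>i\<in>T. measure (m i) (mball_of (M i) (snd p i) (q (fst p) powr a i)))
       \<le> (\<Prod>i\<in>T. measure (m i) (mball_of (M i) (x i) (3 * r)))"
    proof (rule sum_prod_measure_le_of_disjoint_boxes[OF prob fin])
      show "finite T" using T(2) finite_subset by blast
      fix p i assume pi: "p \<in> P" "i \<in> T"
      obtain \<alpha> z where p: "p = (\<alpha>, z)" by (cases p)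
      have i: "i < d" using pi T by auto
      \<comment> \<open>The centre z is within u^a + r of x, the side adds another u^a, and u^a
        \<le> r in the directions of \<open>T\<close>.\<close>
      have "mdist (M i) (z i) (x i) + q \<alpha> powr a i \<le> 3 * r"
        using dist_hit[of \<alpha> z i] wideT[of \<alpha> z i] pi i by (auto simp: p)
      then show "mball_of (M i) (snd p i) (q (fst p) powr a i) \<subseteq> mball_of (M i) (x i) (3 * r)"
        unfolding p fst_conv snd_conv by (intro mball_of_subset_mball_of x i)
    next
      fix p p' assume pp: "p \<in> P" "p' \<in> P" "p \<noteq> p'"
      obtain \<alpha> z \<alpha>' z' where p: "p = (\<alpha>, z)" "p' = (\<alpha>', z')" by (cases p, cases p')
      note P1 = pp(1)[unfolded p] and P2 = pp(2)[unfolded p]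
      obtain i where i: "i < d" "3 * (q \<alpha> powr a i + q \<alpha>' powr a i) \<le> mdist (M i) (z i) (z' i)"
        using sep[OF P1 P2] pp(3) p by blast
      have qp: "q \<alpha> powr a i > 0" "q \<alpha>' powr a i > 0" using P[OF P1] P[OF P2] q_pos by force+
      have "mdist (M i) (z i) (z' i) \<le> mdist (M i) (z i) (x i) + mdist (M i) (x i) (z' i)"
        using z_mem[OF P1 i(1)] z_mem[OF P2 i(1)] x[OF i(1)] by (intro mdist_triangle)
      then have "mdist (M i) (z i) (z' i) < q \<alpha> powr a i + q \<alpha>' powr a i + 2 * r"
        using dist_hit[OF P1 i(1)] dist_hit[OF P2 i(1)] by (simp add: mdist_commute)
      \<comment> \<open>Separation and the common ball give a sum of the two sides below r in this
        direction, which is impossible if both exceed r.\<close>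
      then have "i \<in> T"
        using i(2) wideT[OF P1 i(1)] wideT[OF P2 i(1)] qp by (cases "i \<in> T") simp_all
      moreover have "mball_of (M i) (z i) (q \<alpha> powr a i) \<inter> mball_of (M i) (z' i) (q \<alpha>' powr a i) = {}"
      proof (rule ccontr)
        assume "mball_of (M i) (z i) (q \<alpha> powr a i) \<inter> mball_of (M i) (z' i) (q \<alpha>' powr a i) \<noteq> {}"
        then obtain y where y: "y \<in> mball_of (M i) (z i) (q \<alpha> powr a i)"
            "y \<in> mball_of (M i) (z' i) (q \<alpha>' powr a i)" by blast
        then have "mdist (M i) (z i) (z' i) \<le> mdist (M i) (z i) y + mdist (M i) y (z' i)"
          by (intro mdist_triangle) auto
        then show False using y i qp by (auto simp: mdist_commute)
      qed
      ultimately show "\<exists>i\<in>T. mball_of (M i) (snd p i) (q (fst p) powr a i)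
          \<inter> mball_of (M i) (snd p' i) (q (fst p') powr a i) = {}"
        by (auto simp: p)
    qed auto
    then show ?thesis by (simp add: side_def case_prod_beta)
  qed
  also have "\<dots> \<le> (\<Prod>i\<in>T. K * (3 * r) powr \<delta> i)"
    using T(2) x r by (intro prod_mono conjI ball_upper) auto
  also have "\<dots> = (\<Prod>i\<in>T. K * 3 powr \<delta> i) * (\<Prod>i\<in>T. r powr \<delta> i)"
    using r by (simp add: powr_mult mult_ac flip: prod.distrib)
  finally have sides: "(\<Sum>(\<alpha>, z)\<in>P. \<Prod>i\<in>T. side \<alpha> z i)
      \<le> (\<Prod>i\<in>T. K * 3 powr \<delta> i) * (\<Prod>i\<in>T. r powr \<delta> i)" .
  have "(\<Sum>(\<alpha>, z)\<in>P. w (\<alpha>, z) * (\<Prod>i<d. b \<alpha> z i)) \<le> (\<Sum>(\<alpha>, z)\<in>P. E * (\<Prod>i\<in>T. side \<alpha> z i))"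
    using term_le by (intro sum_mono) auto
  also have "\<dots> = E * (\<Sum>(\<alpha>, z)\<in>P. \<Prod>i\<in>T. side \<alpha> z i)"
    by (simp add: sum_distrib_left case_prod_beta)
  also have "\<dots> \<le> E * ((\<Prod>i\<in>T. K * 3 powr \<delta> i) * (\<Prod>i\<in>T. r powr \<delta> i))"
    using sides E by (rule mult_left_mono)
  also have "\<dots> = H * ((\<Prod>i\<in>T. K * (K * 3 powr \<delta> i)) * (\<Prod>i\<in>{..<d} - T. coord_const i)) * r powr D"
    using prod_r by (simp add: E_def prod.distrib)
  also have "(\<Prod>i\<in>T. K * (K * 3 powr \<delta> i)) * (\<Prod>i\<in>{..<d} - T. coord_const i) = (\<Prod>i<d. coord_const i)"
    unfolding split[of coord_const] by (simp add: coord_const_def power2_eq_square mult_ac)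
  finally show ?thesis by (simp add: b_def D_def)
qed

end

subsection \<open>Separated families of rectangles\<close>

lemma finite_disjoint_refinement:
  assumes "finite I" "\<And>i. i \<in> I \<Longrightarrow> A i \<in> sets N"
  shows "\<exists>B. (\<forall>i\<in>I. B i \<in> sets N \<and> B i \<subseteq> A i) \<and> disjoint_family_on B I \<and> (\<Union>i\<in>I. B i) = (\<Union>i\<in>I. A i)"
  using assms
proof (induction I rule: finite_induct)
  case empty
  show ?case by (simp add: disjoint_family_on_def)
next
  case (insert k I)
  then obtain B where B: "\<And>i. i \<in> I \<Longrightarrow> B i \<in> sets N \<and> B i \<subseteq> A i" "disjoint_family_on B I"
      "(\<Union>i\<in>I. B i) = (\<Union>i\<in>I. A i)"
    by (metis insertCI)
  have "A k - (\<Union>i\<in>I. A i) \<in> sets N"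
    using insert by (intro sets.Diff sets.finite_UN) auto
  with B insert.hyps show ?case
    by (intro exI[of _ "B(k := A k - (\<Union>i\<in>I. A i))"])
      (auto simp: disjoint_family_on_def)
qed

lemma emeasure_density_sum_indicator:
  fixes w :: "'p \<Rightarrow> real"
  assumes "finite_measure N" "\<And>p. p \<in> P \<Longrightarrow> G p \<in> sets N" "\<And>p. p \<in> P \<Longrightarrow> w p \<ge> 0" "A \<in> sets N"
  shows "emeasure (density N (\<lambda>x. \<Sum>p\<in>P. ennreal (w p) * indicator (G p) x)) A
       = ennreal (\<Sum>p\<in>P. w p * measure N (A \<inter> G p))"
proof -
  interpret finite_measure N by fact
  have "emeasure (density N (\<lambda>x. \<Sum>p\<in>P. ennreal (w p) * indicator (G p) x)) A
      = (\<integral>\<^sup>+x. (\<Sum>p\<in>P. ennreal (w p) * indicator (G p) x) * indicator A x \<partial>N)"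
    using assms by (intro emeasure_density) auto
  also have "\<dots> = (\<integral>\<^sup>+x. (\<Sum>p\<in>P. ennreal (w p) * indicator (A \<inter> G p) x) \<partial>N)"
    by (intro nn_integral_cong) (auto simp: sum_distrib_right indicator_def intro!: sum.cong)
  also have "\<dots> = (\<Sum>p\<in>P. \<integral>\<^sup>+x. ennreal (w p) * indicator (A \<inter> G p) x \<partial>N)"
    using assms by (intro nn_integral_sum) auto
  also have "\<dots> = (\<Sum>p\<in>P. ennreal (w p * measure N (A \<inter> G p)))"
    using assms by (intro sum.cong refl)
      (simp add: nn_integral_cmult_indicator emeasure_eq_measure ennreal_mult)
  also have "\<dots> = ennreal (\<Sum>p\<in>P. w p * measure N (A \<inter> G p))"
    using assms by (intro sum_ennreal) auto
  finally show ?thesis .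
qed

context resonant_system
begin

definition core_box :: "'j \<times> (nat \<Rightarrow> 'a) \<Rightarrow> (nat \<Rightarrow> 'a) set" where
  "core_box p = PiE {..<d} (core (fst p) (snd p))"

lemma core_box_sets [measurable]: "core_box p \<in> sets Pm"
  unfolding core_box_def by (intro sets_PiM_I_finite) auto

lemma measure_core_box: "measure Pm (core_box p) = (\<Prod>i<d. measure (m i) (core (fst p) (snd p) i))"
  unfolding core_box_def by (rule P.prob_times) auto

lemma measure_pball_core_box:
  "measure Pm (pball x r \<inter> core_box p)
     = (\<Prod>i<d. measure (m i) (mball_of (M i) (x i) r \<inter> core (fst p) (snd p) i))"
  unfolding core_box_def pball_def PiE_Int by (rule P.prob_times) auto

text \<open>The factor 3, rather than 1, leaves room for a ball between the rectangles: if both meet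
  a ball of radius r and are separated in a direction, both are shorter than r there. It reappears
  as the 6 in \<open>ex_separated_cover\<close>.\<close>

definition separated :: "('j \<times> (nat \<Rightarrow> 'a)) set \<Rightarrow> bool" where
  "separated P \<longleftrightarrow> (\<forall>p\<in>P. \<forall>p'\<in>P. p \<noteq> p' \<longrightarrow>
     (\<exists>i<d. 3 * (q (fst p) powr a i + q (fst p') powr a i) \<le> mdist (M i) (snd p i) (snd p' i)))"

lemma separated_insert:
  assumes "separated P" "\<forall>p\<in>P. \<exists>i<d. 3 * (q b powr a i + q (fst p) powr a i) \<le> mdist (M i) (z i) (snd p i)"
  shows "separated (insert (b, z) P)"
proof -
  have *: "\<forall>p\<in>P. \<exists>i<d. 3 * (q (fst p) powr a i + q b powr a i) \<le> mdist (M i) (snd p i) (z i)"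
    using assms(2) by (metis add.commute mdist_commute)
  show ?thesis
    unfolding separated_def
  proof (intro ballI impI)
    fix p p' assume "p \<in> insert (b, z) P" "p' \<in> insert (b, z) P" "p \<noteq> p'"
    then consider "p \<in> P" "p' \<in> P" | "p = (b, z)" "p' \<in> P" | "p \<in> P" "p' = (b, z)" by blast
    then show "\<exists>i<d. 3 * (q (fst p) powr a i + q (fst p') powr a i) \<le> mdist (M i) (snd p i) (snd p' i)"
    proof cases
      case 1
      then show ?thesis using assms(1) \<open>p \<noteq> p'\<close> unfolding separated_def by blast
    next
      case 2
      then show ?thesis using assms(2) by simp
    next
      case 3
      then show ?thesis using * by simp
    qed
  qed
qed

text \<open>Sorting the rectangles by the set of directions in which they are at most r long gives
  at most 2^d classes, each controlled by \<open>small_ball_class\<close>.\<close>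

lemma small_ball_estimate:
  assumes fin: "finite P" and sep: "separated P"
    and P: "\<And>p i. p \<in> P \<Longrightarrow> i < d \<Longrightarrow> fst p \<in> J \<and> q (fst p) < 1 \<and> snd p i \<in> R (fst p) i \<and> q (fst p) powr a i \<le> r0"
    and w: "\<And>p. p \<in> P \<Longrightarrow> 0 \<le> w p \<and>
        w p * measure Pm (core_box p) \<le> H * (\<Prod>i<d. q (fst p) powr (a i * \<delta> i))"
    and H: "H \<ge> 0" and x: "x \<in> space Pm" and r: "0 < r" "3 * r \<le> r0"
  shows "(\<Sum>p\<in>P. w p * measure Pm (pball x r \<inter> core_box p))
      \<le> 2 ^ d * (H * (\<Prod>i<d. coord_const i) * r powr dimnum d \<delta> \<kappa> a t)"
proof -
  define f where "f p = w p * measure Pm (pball x r \<inter> core_box p)" for p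
  define B where "B = H * (\<Prod>i<d. coord_const i) * r powr dimnum d \<delta> \<kappa> a t"
  define PT where "PT T = {p\<in>P. wide r (q (fst p)) = T}" for T
  have xi: "\<And>i. i < d \<Longrightarrow> x i \<in> mspace (M i)" using x by (auto simp: space_Pm PiE_iff)
  have "sum f (PT T) \<le> B" if T: "T \<in> Pow {..<d}" for T
  proof -
    \<comment> \<open>A core that the ball misses in one direction contributes no mass, and the
      class estimate needs every core to be hit.\<close>
    define PH where "PH = {p\<in>PT T. \<forall>i<d. mball_of (M i) (x i) r \<inter> core (fst p) (snd p) i \<noteq> {}}"
    have "f p = 0" if p: "p \<in> PT T - PH" for p
    proof -
      obtain i where "i < d" "mball_of (M i) (x i) r \<inter> core (fst p) (snd p) i = {}"
        using p by (auto simp: PH_def)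
      then have "(\<Prod>i<d. measure (m i) (mball_of (M i) (x i) r \<inter> core (fst p) (snd p) i)) = 0"
        by (intro prod_zero bexI[of _ i]) auto
      then show ?thesis unfolding f_def measure_pball_core_box by simp
    qed
    then have "sum f (PT T) = sum f PH"
      using fin by (intro sum.mono_neutral_right) (auto simp: PH_def PT_def)
    also have "\<dots> = (\<Sum>(\<alpha>, z)\<in>PH. w (\<alpha>, z) * (\<Prod>i<d. measure (m i) (mball_of (M i) (x i) r \<inter> core \<alpha> z i)))"
      unfolding f_def measure_pball_core_box by (simp add: case_prod_beta)
    also have "\<dots> \<le> B"
      unfolding B_def
    proof (rule small_ball_class[where T = T])
      show "finite PH" using fin by (auto simp: PH_def PT_def)
      fix \<alpha> z assume p: "(\<alpha>, z) \<in> PH"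
      then have p': "(\<alpha>, z) \<in> P" by (auto simp: PH_def PT_def)
      show "\<alpha> \<in> J \<and> q \<alpha> < 1 \<and> (\<forall>i<d. z i \<in> R \<alpha> i \<and> q \<alpha> powr a i \<le> r0)"
        using P[OF p'] d_pos by (metis fst_conv le_eq_less_or_eq less_one linorder_not_less not_gr_zero snd_conv)
      show "wide r (q \<alpha>) = T" using p by (auto simp: PH_def PT_def)
      show "0 \<le> w (\<alpha>, z) \<and> w (\<alpha>, z) * (\<Prod>i<d. measure (m i) (core \<alpha> z i))
          \<le> H * (\<Prod>i<d. q \<alpha> powr (a i * \<delta> i))"
        using w[OF p'] by (simp add: measure_core_box)
      show "mball_of (M i) (x i) r \<inter> core \<alpha> z i \<noteq> {}" if "i < d" for i
        using p that by (auto simp: PH_def)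
    next
      fix \<alpha> z \<alpha>' z' assume "(\<alpha>, z) \<in> PH" "(\<alpha>', z') \<in> PH" "(\<alpha>, z) \<noteq> (\<alpha>', z')"
      then show "\<exists>i<d. 3 * (q \<alpha> powr a i + q \<alpha>' powr a i) \<le> mdist (M i) (z i) (z' i)"
        using sep unfolding separated_def PH_def PT_def by force
    qed (use T H r xi in auto)
    finally show ?thesis .
  qed
  then have "(\<Sum>T\<in>Pow {..<d}. sum f (PT T)) \<le> of_nat (card (Pow {..<d})) * B"
    by (intro sum_bounded_above) auto
  also have "(\<Sum>T\<in>Pow {..<d}. sum f (PT T)) = sum f P"
    unfolding PT_def using fin by (intro sum.group) (auto simp: wide_def)
  finally show ?thesis by (simp add: f_def B_def card_Pow)
qed

lemma mspace_sets: "mspace (M i) \<in> sets (m i)"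
  by (metis sets.top space_m)

text \<open>Separated rectangles are disjoint boxes in a probability space, and as \<open>S\<close>
  is finite their masses have a common positive lower bound. The centres may range over an infinite
  set; this bound is what provides maximal separated families.\<close>

lemma separated_card_bound:
  assumes S: "finite S" "\<And>\<alpha>. \<alpha> \<in> S \<Longrightarrow> \<alpha> \<in> J" "\<And>\<alpha> i. \<alpha> \<in> S \<Longrightarrow> i < d \<Longrightarrow> q \<alpha> powr a i \<le> r0"
  shows "\<exists>N. \<forall>P. finite P \<and> P \<subseteq> S \<times> {z. \<forall>i<d. z i \<in> mspace (M i)} \<and> separated P \<longrightarrow> card P \<le> N"
proof -
  define v where "v \<alpha> = (\<Prod>i<d. (q \<alpha> powr a i) powr \<delta> i / K)" for \<alpha>
  have v_pos: "v \<alpha> > 0" if "\<alpha> \<in> S" for \<alpha>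
    unfolding v_def using q_pos[OF S(2)[OF that]] K_ge by (intro prod_pos ballI divide_pos_pos) auto
  \<comment> \<open>Inserting 1 keeps the minimum defined when \<open>S\<close> is empty.\<close>
  define c where "c = Min (insert 1 (v ` S))"
  have c: "c > 0" "\<And>\<alpha>. \<alpha> \<in> S \<Longrightarrow> c \<le> v \<alpha>"
    using v_pos S(1) by (auto simp: c_def)
  have "card P \<le> nat \<lceil>1 / c\<rceil>"
    if P: "finite P" "P \<subseteq> S \<times> {z. \<forall>i<d. z i \<in> mspace (M i)}" "separated P" for P
  proof -
    have "of_nat (card P) * c = (\<Sum>p\<in>P. c)" by simp
    also have "\<dots> \<le> (\<Sum>p\<in>P. \<Prod>i<d. measure (m i) (mball_of (M i) (snd p i) (q (fst p) powr a i)))"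
    proof (intro sum_mono)
      fix p assume p: "p \<in> P"
      then have *: "fst p \<in> S" "\<And>i. i < d \<Longrightarrow> snd p i \<in> mspace (M i)" using P(2) by auto
      have "c \<le> v (fst p)" using * c by simp
      also have "\<dots> \<le> (\<Prod>i<d. measure (m i) (mball_of (M i) (snd p i) (q (fst p) powr a i)))"
        unfolding v_def
      proof (intro prod_mono conjI)
        fix i assume i: "i \<in> {..<d}"
        show "0 \<le> (q (fst p) powr a i) powr \<delta> i / K" using K_ge by simp
        have "(q (fst p) powr a i) powr \<delta> i
            \<le> K * measure (m i) (mball_of (M i) (snd p i) (q (fst p) powr a i))"
          using * S(2,3) q_pos[of "fst p"] i by (intro ball_lower) auto
        then show "(q (fst p) powr a i) powr \<delta> i / K
            \<le> measure (m i) (mball_of (M i) (snd p i) (q (fst p) powr a i))"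
          using K_ge by (simp add: field_simps)
      qed
      finally show "c \<le> (\<Prod>i<d. measure (m i) (mball_of (M i) (snd p i) (q (fst p) powr a i)))" .
    qed
    also have "\<dots> \<le> (\<Prod>i<d. measure (m i) (mspace (M i)))"
    proof (rule sum_prod_measure_le_of_disjoint_boxes[OF prob P(1)])
      fix p p' assume pp: "p \<in> P" "p' \<in> P" "p \<noteq> p'"
      then obtain i where i: "i < d" "3 * (q (fst p) powr a i + q (fst p') powr a i) \<le> mdist (M i) (snd p i) (snd p' i)"
        using P(3) unfolding separated_def by blast
      have "fst p \<in> J" "fst p' \<in> J" using pp P(2) S(2) by auto
      then have qp: "q (fst p) powr a i > 0" "q (fst p') powr a i > 0" using q_pos by force+
      have "mball_of (M i) (snd p i) (q (fst p) powr a i) \<inter> mball_of (M i) (snd p' i) (q (fst p') powr a i) = {}"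
      proof (rule ccontr)
        assume "mball_of (M i) (snd p i) (q (fst p) powr a i) \<inter> mball_of (M i) (snd p' i) (q (fst p') powr a i) \<noteq> {}"
        then obtain y where y: "y \<in> mball_of (M i) (snd p i) (q (fst p) powr a i)"
            "y \<in> mball_of (M i) (snd p' i) (q (fst p') powr a i)" by blast
        then have "mdist (M i) (snd p i) (snd p' i) \<le> mdist (M i) (snd p i) y + mdist (M i) y (snd p' i)"
          by (intro mdist_triangle) auto
        then show False using y i qp by (auto simp: mdist_commute)
      qed
      then show "\<exists>i\<in>{..<d}. mball_of (M i) (snd p i) (q (fst p) powr a i) \<inter> mball_of (M i) (snd p' i) (q (fst p') powr a i) = {}"
        using i by blast
    qed (auto simp: mspace_sets)
    also have "\<dots> = 1" using prob_space.prob_space[OF prob] by (simp flip: space_m)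
    finally have "real (card P) \<le> 1 / c" using c by (simp add: field_simps)
    also have "\<dots> \<le> real (nat \<lceil>1 / c\<rceil>)" by (rule real_nat_ceiling_ge)
    finally show ?thesis by simp
  qed
  then show ?thesis by blast
qed

text \<open>Greedy selection by decreasing size, as in the \<open>5r\<close>-covering lemma: rectangles with sides
  \<open>q \<alpha> powr a i\<close> are balls for the quasi-metric \<open>max\<^sub>i |x\<^sub>i - y\<^sub>i| powr (1 / a i)\<close>.\<close>

lemma ex_separated_cover:
  assumes "finite S" and "\<And>\<alpha>. \<alpha> \<in> S \<Longrightarrow> \<alpha> \<in> J" "\<And>\<alpha> i. \<alpha> \<in> S \<Longrightarrow> i < d \<Longrightarrow> q \<alpha> powr a i \<le> r0"
    and Z: "\<And>\<alpha> z i. \<alpha> \<in> S \<Longrightarrow> z \<in> Z \<alpha> \<Longrightarrow> i < d \<Longrightarrow> z i \<in> mspace (M i)"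
  shows "\<exists>P. finite P \<and> P \<subseteq> Sigma S Z \<and> separated P \<and>
    (\<forall>\<alpha>\<in>S. \<forall>z\<in>Z \<alpha>. \<exists>p\<in>P. q \<alpha> \<le> q (fst p) \<and> (\<forall>i<d. mdist (M i) (z i) (snd p i) < 6 * q (fst p) powr a i))"
  using assms
proof (induction "card S" arbitrary: S)
  case 0
  then show ?case by (auto simp: separated_def)
next
  case (Suc n)
  note SJ = Suc.prems(2) and Sr = Suc.prems(3) and SZ = Suc.prems(4)
  have "S \<noteq> {}" using Suc by auto
  \<comment> \<open>Removing the smallest size means that the induction has already dealt with the
    larger ones, so a rectangle of size \<open>q b\<close> is only compared with rectangles at least
    as large.\<close>
  then obtain b where b: "b \<in> S" "\<And>\<alpha>. \<alpha> \<in> S \<Longrightarrow> q b \<le> q \<alpha>"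
    using Suc.prems(1) by (metis arg_min_if_finite(1) arg_min_least)
  have "n = card (S - {b})" using Suc b by simp
  then have "\<exists>P. finite P \<and> P \<subseteq> Sigma (S - {b}) Z \<and> separated P \<and>
    (\<forall>\<alpha>\<in>S - {b}. \<forall>z\<in>Z \<alpha>. \<exists>p\<in>P. q \<alpha> \<le> q (fst p) \<and> (\<forall>i<d. mdist (M i) (z i) (snd p i) < 6 * q (fst p) powr a i))"
    using Suc.prems by (intro Suc.hyps(1)) auto
  then obtain P0 where P0: "finite P0" "P0 \<subseteq> Sigma (S - {b}) Z" "separated P0"
    "\<And>\<alpha> z. \<alpha> \<in> S - {b} \<Longrightarrow> z \<in> Z \<alpha> \<Longrightarrow> \<exists>p\<in>P0. q \<alpha> \<le> q (fst p) \<and> (\<forall>i<d. mdist (M i) (z i) (snd p i) < 6 * q (fst p) powr a i)"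
    by blast
  define ok where "ok P \<longleftrightarrow> finite P \<and> P0 \<subseteq> P \<and> P \<subseteq> Sigma S Z \<and> separated P" for P
  have "\<exists>N. \<forall>P. finite P \<and> P \<subseteq> S \<times> {z. \<forall>i<d. z i \<in> mspace (M i)} \<and> separated P \<longrightarrow> card P \<le> N"
    by (rule separated_card_bound) (fact Suc.prems(1) SJ Sr)+
  then obtain N where N: "\<forall>P. finite P \<and> P \<subseteq> S \<times> {z. \<forall>i<d. z i \<in> mspace (M i)} \<and> separated P \<longrightarrow> card P \<le> N" ..
  have "card P < Suc N" if "ok P" for P
  proof -
    have "Sigma S Z \<subseteq> S \<times> {z. \<forall>i<d. z i \<in> mspace (M i)}" using SZ by auto
    then show ?thesis using that N unfolding ok_def by (meson less_Suc_eq_le order_trans)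
  qed
  then have "\<forall>P. ok P \<longrightarrow> card P < Suc N" by blast
  moreover have "ok P0" using P0 by (auto simp: ok_def)
  \<comment> \<open>Largest cardinality among the finite separated extensions of \<open>P0\<close>
    implies that no further rectangle of the last size can be added.\<close>
  ultimately obtain P where P: "ok P" "\<And>Q. ok Q \<Longrightarrow> card Q \<le> card P"
    using Lattices_Big.ex_has_greatest_nat[of ok P0 card "Suc N"] by blast
  have "\<exists>p\<in>P. q \<alpha> \<le> q (fst p) \<and> (\<forall>i<d. mdist (M i) (z i) (snd p i) < 6 * q (fst p) powr a i)"
    if \<alpha>: "\<alpha> \<in> S" "z \<in> Z \<alpha>" for \<alpha> z
  proof (cases "\<alpha> = b")
    case False
    then show ?thesis using P0(4)[of \<alpha> z] \<alpha> P(1) by (auto simp: ok_def)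
  next
    case True
    have qb: "q b > 0" using b SJ q_pos by auto
    show ?thesis
    proof (cases "(b, z) \<in> P")
      case True
      then show ?thesis
        using SZ[OF \<alpha>] qb \<open>\<alpha> = b\<close> by (intro bexI[of _ "(b, z)"]) (auto simp: mdist_self)
    next
      case new: False
      have fin: "finite P" using P(1) by (simp add: ok_def)
      have "\<not> ok (insert (b, z) P)" using P(2)[of "insert (b, z) P"] new fin by auto
      then have "\<not> separated (insert (b, z) P)" using P(1) \<alpha> True by (auto simp: ok_def)
      then obtain p where p: "p \<in> P" "\<And>i. i < d \<Longrightarrow>
          mdist (M i) (z i) (snd p i) < 3 * (q b powr a i + q (fst p) powr a i)"
        using separated_insert[of P b z] P(1) unfolding ok_def by (meson not_le)
      have "fst p \<in> S" using p P(1) by (auto simp: ok_def)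
      \<comment> \<open>As \<open>q b\<close> is the smallest size, 3 * (q_b^a + q_p^a) \<le> 6 *
        q_p^a.\<close>
      then have "q b powr a i \<le> q (fst p) powr a i" for i
        using b qb a_pos[of i] by (intro powr_mono2) auto
      then have "\<forall>i<d. mdist (M i) (z i) (snd p i) < 6 * q (fst p) powr a i"
        using p(2) by (smt (verit, best))
      then show ?thesis using p(1) True b(2)[OF \<open>fst p \<in> S\<close>] by blast
    qed
  qed
  then show ?case using P(1) unfolding ok_def by blast
qed

end

subsection \<open>Transferring mass to the thinner set\<close>

lemma ex_small_powr:
  fixes a :: "nat \<Rightarrow> real"
  assumes "\<And>i. a i > 0" "\<theta> > 0"
  shows "\<exists>\<tau>>0. \<tau> < 1 \<and> (\<forall>u i. 0 < u \<longrightarrow> u < \<tau> \<longrightarrow> i < d \<longrightarrow> u powr a i \<le> \<theta>)"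
proof -
  define \<tau> where "\<tau> = Min (insert (1/2) ((\<lambda>i. \<theta> powr (1 / a i)) ` {..<d}))"
  have "\<tau> > 0" using assms by (auto simp: \<tau>_def)
  moreover have "\<tau> \<le> 1/2" unfolding \<tau>_def by (rule Min_le) auto
  moreover have "u powr a i \<le> \<theta>" if "0 < u" "u < \<tau>" "i < d" for u i
  proof -
    have "\<tau> \<le> \<theta> powr (1 / a i)" unfolding \<tau>_def using that by (intro Min_le) auto
    then have "u powr a i \<le> (\<theta> powr (1 / a i)) powr a i"
      using that assms(1)[of i] by (intro powr_mono2) auto
    also have "\<dots> = \<theta>" using assms(1)[of i] assms(2) by (simp add: powr_powr)
    finally show ?thesis .
  qed
  ultimately show ?thesis by (intro exI[of _ \<tau>]) auto
qed

context resonant_system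
begin

definition outer_box :: "'j \<Rightarrow> (nat \<Rightarrow> 'a) set" where
  "outer_box \<alpha> = PiE {..<d} (\<lambda>i. nbhd (M i) (R \<alpha> i) (q \<alpha> powr a i))"

definition target_box :: "'j \<Rightarrow> (nat \<Rightarrow> 'a) set" where
  "target_box \<alpha> = PiE {..<d} (\<lambda>i. nbhd (M i) (R \<alpha> i) (q \<alpha> powr (a i + t i)))"

lemma outer_box_sets [measurable]: "outer_box \<alpha> \<in> sets Pm"
  unfolding outer_box_def by (intro sets_PiM_I_finite) auto

text \<open>A point in infinitely many outer boxes lies in one whose index avoids the finite set
  \<open>S1\<close>. So the remaining countably many boxes still cover almost everything, and
  continuity from below leaves finitely many of them.\<close>

lemma finite_outer_cover:
  assumes S1: "finite S1" and e: "e > 0"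
  shows "\<exists>S. finite S \<and> S \<subseteq> J - S1 \<and> measure Pm (space Pm - (\<Union>\<alpha>\<in>S. outer_box \<alpha>)) \<le> e"
proof -
  have ne: "J - S1 \<noteq> {}" using J_infinite S1 by (metis Diff_infinite_finite finite.emptyI)
  define en where "en = from_nat_into (J - S1)"
  have range: "range en = J - S1"
    unfolding en_def using ne J_countable by (intro range_from_nat_into) auto
  define A where "A n = (\<Union>k\<le>n. outer_box (en k))" for n :: nat
  have A: "A n \<in> sets Pm" for n unfolding A_def by auto
  have "incseq A" unfolding A_def incseq_def by fastforce
  then have "(\<lambda>n. measure Pm (A n)) \<longlonglongrightarrow> measure Pm (\<Union>n. A n)"
    using A by (intro P.finite_Lim_measure_incseq) auto
  moreover have "measure Pm (\<Union>n. A n) = 1"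
  proof -
    have "AE x in Pm. x \<in> (\<Union>n. A n)"
    proof (rule AE_mp[OF full], rule AE_I2, rule impI)
      fix x assume x: "x \<in> space Pm"
        and inf: "infinite {\<alpha>\<in>J. \<forall>i<d. x i \<in> nbhd (M i) (R \<alpha> i) (q \<alpha> powr a i)}"
      have "\<not> {\<alpha>\<in>J. \<forall>i<d. x i \<in> nbhd (M i) (R \<alpha> i) (q \<alpha> powr a i)} \<subseteq> S1"
        using inf S1 finite_subset by blast
      then obtain \<alpha> where \<alpha>: "\<alpha> \<in> J - S1" "\<forall>i<d. x i \<in> nbhd (M i) (R \<alpha> i) (q \<alpha> powr a i)" by blast
      then have "x \<in> outer_box \<alpha>" using x by (auto simp: outer_box_def space_Pm PiE_iff)
      moreover obtain n where "\<alpha> = en n" using \<alpha> range by blast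
      ultimately show "x \<in> (\<Union>n. A n)" unfolding A_def by blast
    qed
    then show ?thesis using A P.prob_eq_1 by auto
  qed
  ultimately have "(\<lambda>n. measure Pm (A n)) \<longlonglongrightarrow> 1" by simp
  then have "eventually (\<lambda>n. dist (measure Pm (A n)) 1 < e) sequentially"
    using e by (rule tendstoD)
  then obtain n where n: "dist (measure Pm (A n)) 1 < e" by (auto simp: eventually_sequentially)
  have "measure Pm (space Pm - A n) \<le> e"
    using n P.prob_compl[OF A[of n]] by (simp add: dist_real_def)
  moreover have "A n = (\<Union>\<alpha>\<in>en ` {..n}. outer_box \<alpha>)" by (simp add: A_def)
  moreover have "en ` {..n} \<subseteq> J - S1" using range by blast
  ultimately show ?thesis by (intro exI[of _ "en ` {..n}"]) auto
qed

text \<open>The invariant of the iteration. The density bound \<open>H\<close> is only existential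
  because it may worsen in each round; the ball bound carries its constant \<open>C\<close>
  explicitly because that one must be controlled.\<close>

definition spread :: "real \<Rightarrow> real \<Rightarrow> (nat \<Rightarrow> 'a) measure \<Rightarrow> (nat \<Rightarrow> 'a) set \<Rightarrow> bool" where
  "spread s C \<nu> V \<longleftrightarrow> sets \<nu> = sets Pm \<and> finite_measure \<nu> \<and> approx_inside V \<and>
     measure \<nu> (space Pm - V) = 0 \<and> (\<exists>H\<ge>0. \<forall>A\<in>sets Pm. measure \<nu> A \<le> H * measure Pm A) \<and>
     (\<forall>x\<in>space Pm. \<forall>r>0. measure \<nu> (pball x r) \<le> C * r powr s)"

text \<open>The order of choices makes this work: \<open>H\<close> determines \<open>L\<close> and
  \<open>rs\<close>, these determine the admissible displacement \<open>gap\<close>, and only then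
  are the rectangles chosen, small in comparison. Avoiding \<open>S0\<close> supplies fresh indices
  in each round.\<close>

lemma ex_mass_transfer:
  assumes \<nu>: "spread s C \<nu> V"
    and C: "0 < C" "C < C'" and s: "0 < s" "s < dimnum d \<delta> \<kappa> a t"
    and \<epsilon>: "\<epsilon> > 0" and S0: "finite S0"
  shows "\<exists>\<nu>' V' S \<eta>. spread s C' \<nu>' V' \<and> measure \<nu> V - \<epsilon> \<le> measure \<nu>' V' \<and>
     finite S \<and> S \<inter> S0 = {} \<and> S \<subseteq> J \<and> V' \<subseteq> (\<Union>\<alpha>\<in>S. target_box \<alpha>) \<and> V' \<subseteq> V \<and>
     \<eta> > 0 \<and> (\<forall>x\<in>V'. pball x \<eta> \<subseteq> V)"
proof -
  define D where "D = dimnum d \<delta> \<kappa> a t"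
  have sets_\<nu>: "sets \<nu> = sets Pm" and V: "approx_inside V"
    and \<nu>_ball: "\<And>x r. x \<in> space Pm \<Longrightarrow> r > 0 \<Longrightarrow> measure \<nu> (pball x r) \<le> C * r powr s"
    using \<nu> by (auto simp: spread_def)
  interpret \<nu>: finite_measure \<nu> using \<nu> by (simp add: spread_def)
  obtain H where H: "H \<ge> 0" "\<And>A. A \<in> sets Pm \<Longrightarrow> measure \<nu> A \<le> H * measure Pm A"
    using \<nu> by (auto simp: spread_def)
  \<comment> \<open>Relates the mass of a rectangle with sides enlarged 7 times to the product of
    the u^(a * \<delta>).\<close>
  define H1 where "H1 = H * (\<Prod>i<d. K * 7 powr \<delta> i)"
  have H1: "H1 \<ge> 0" unfolding H1_def using H K_ge by (intro mult_nonneg_nonneg prod_nonneg) auto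
  define L where "L = 2 ^ d * (H1 * (\<Prod>i<d. coord_const i)) + 1"
  have L: "L > 0" unfolding L_def using H1 coord_const_ge
    by (intro add_nonneg_pos mult_nonneg_nonneg prod_nonneg) auto

  \<comment> \<open>The gain D - s > 0 absorbs \<open>L\<close> below the second entry; r0 / 3
    allows for the enlarged radius 3 * r.\<close>
  define rs where "rs = min (r0 / 3) ((C' / L) powr (1 / (D - s)))"
  have rs: "rs > 0" "3 * rs \<le> r0" using r0 C L by (auto simp: rs_def)
  have small: "L * r powr D \<le> C' * r powr s" if r: "0 < r" "r \<le> rs" for r
  proof -
    have Ds: "D - s > 0" using s by (simp add: D_def)
    have "r \<le> (C' / L) powr (1 / (D - s))" using r by (simp add: rs_def)
    then have "r powr (D - s) \<le> ((C' / L) powr (1 / (D - s))) powr (D - s)"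
      using r Ds by (intro powr_mono2) auto
    also have "\<dots> = C' / L" using Ds C L by (simp add: powr_powr)
    finally have "L * r powr (D - s) * r powr s \<le> C' * r powr s"
      using L by (intro mult_right_mono) (auto simp: field_simps)
    then show ?thesis by (simp add: mult.assoc flip: powr_add)
  qed
  \<comment> \<open>Dilating a ball by \<open>\<Lambda>\<close> costs exactly the passage from C to
    C', and for r > \<open>rs\<close> a displacement by \<open>gap\<close> stays within this
    dilation.\<close>
  define \<Lambda> where "\<Lambda> = (C' / C) powr (1 / s)"
  have \<Lambda>: "\<Lambda> > 1" unfolding \<Lambda>_def using C s by (intro gr_one_powr) auto
  have \<Lambda>s: "C * \<Lambda> powr s = C'" unfolding \<Lambda>_def using C s by (simp add: powr_powr)
  define gap where "gap = (\<Lambda> - 1) * rs"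
  have gap: "gap > 0" using \<Lambda> rs by (simp add: gap_def)

  \<comment> \<open>Mass is lost twice, on V - V0 and outside the outer boxes, each time at most H *
    \<epsilon>' \<le> \<epsilon> / 2.\<close>
  define \<epsilon>' where "\<epsilon>' = \<epsilon> / (2 * (H + 1))"
  have \<epsilon>': "\<epsilon>' > 0" "H * \<epsilon>' \<le> \<epsilon> / 2"
    using \<epsilon> H by (auto simp: \<epsilon>'_def field_simps)
  obtain V0 \<eta> where V0: "V0 \<in> sets Pm" "\<eta> > 0" "V0 \<subseteq> V" "measure Pm (V - V0) \<le> \<epsilon>'"
      "\<forall>x\<in>V0. pball x \<eta> \<subseteq> V"
    using V \<epsilon>'(1) unfolding approx_inside_def by blast
  have V_sets: "V \<in> sets Pm" using V by (rule approx_inside_sets)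

  \<comment> \<open>The 8 is 1 + 7: a point of a core and a point of the 7-fold enlargement are less
    than 8 sides apart.\<close>
  define \<theta> where "\<theta> = min r0 (min gap \<eta>) / 8"
  have \<theta>: "\<theta> > 0" "8 * \<theta> \<le> r0" "8 * \<theta> \<le> gap" "8 * \<theta> \<le> \<eta>"
    using r0 gap V0 by (auto simp: \<theta>_def)
  obtain \<tau> where \<tau>: "\<tau> > 0" "\<tau> < 1" "\<And>u i. 0 < u \<Longrightarrow> u < \<tau> \<Longrightarrow> i < d \<Longrightarrow> u powr a i \<le> \<theta>"
    using ex_small_powr[of a \<theta> d] a_pos \<theta> by metis
  obtain S where S: "finite S" "S \<subseteq> J - (S0 \<union> {\<alpha>\<in>J. q \<alpha> \<ge> \<tau>})"
      "measure Pm (space Pm - (\<Union>\<alpha>\<in>S. outer_box \<alpha>)) \<le> \<epsilon>'"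
    using finite_outer_cover[of "S0 \<union> {\<alpha>\<in>J. q \<alpha> \<ge> \<tau>}" \<epsilon>'] S0 q_finite[OF \<tau>(1)] \<epsilon>' by auto
  have SJ: "\<alpha> \<in> J" and Sq: "0 < q \<alpha>" "q \<alpha> < \<tau>" if "\<alpha> \<in> S" for \<alpha>
    using S(2) that q_pos by (auto simp: not_le)
  have S\<theta>: "q \<alpha> powr a i \<le> \<theta>" if "\<alpha> \<in> S" "i < d" for \<alpha> i
    using \<tau>(3) Sq[OF that(1)] that(2) by simp

  \<comment> \<open>Admitting only centres close to \<open>V0\<close>, not merely to
    \<open>V\<close>, puts the cores into \<open>V\<close> with a margin.\<close>
  define Z where "Z \<alpha> = {z. \<exists>x\<in>V0. \<forall>i<d. z i \<in> R \<alpha> i \<and> mdist (M i) (x i) (z i) < q \<alpha> powr a i}" for \<alpha>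
  have Z_mem: "z i \<in> mspace (M i)" if "\<alpha> \<in> S" "z \<in> Z \<alpha>" "i < d" for \<alpha> z i
    using that SJ R_sub by (fastforce simp: Z_def)
  have "\<exists>P. finite P \<and> P \<subseteq> Sigma S Z \<and> separated P \<and>
    (\<forall>\<alpha>\<in>S. \<forall>z\<in>Z \<alpha>. \<exists>p\<in>P. q \<alpha> \<le> q (fst p) \<and> (\<forall>i<d. mdist (M i) (z i) (snd p i) < 6 * q (fst p) powr a i))"
    using S(1) SJ S\<theta> \<theta> Z_mem by (intro ex_separated_cover) force+
  then obtain P where P: "finite P" "P \<subseteq> Sigma S Z" "separated P"
    and P_cover: "\<And>\<alpha> z. \<alpha> \<in> S \<Longrightarrow> z \<in> Z \<alpha> \<Longrightarrow>
      \<exists>p\<in>P. q \<alpha> \<le> q (fst p) \<and> (\<forall>i<d. mdist (M i) (z i) (snd p i) < 6 * q (fst p) powr a i)"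
    by blast
  have PS: "fst p \<in> S" "snd p \<in> Z (fst p)" if "p \<in> P" for p using that P(2) by auto
  have PR: "snd p i \<in> R (fst p) i" and PM: "snd p i \<in> mspace (M i)" if "p \<in> P" "i < d" for p i
    using PS[OF that(1)] that(2) Z_mem by (auto simp: Z_def)
  define \<sigma> where "\<sigma> p i = q (fst p) powr a i" for p :: "'j \<times> (nat \<Rightarrow> 'a)" and i
  have \<sigma>: "0 < \<sigma> p i" "\<sigma> p i \<le> \<theta>" if "p \<in> P" "i < d" for p i
    using PS[OF that(1)] Sq S\<theta> that(2) by (auto simp: \<sigma>_def less_imp_neq[symmetric])
  define Q where "Q p = PiE {..<d} (\<lambda>i. mball_of (M i) (snd p i) (7 * \<sigma> p i))" for p
  have Q_sets: "Q p \<in> sets Pm" for p unfolding Q_def by (intro sets_PiM_I_finite) auto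

  have V0_cover: "V0 \<inter> (\<Union>\<alpha>\<in>S. outer_box \<alpha>) \<subseteq> (\<Union>p\<in>P. Q p)"
  proof
    fix x assume "x \<in> V0 \<inter> (\<Union>\<alpha>\<in>S. outer_box \<alpha>)"
    then obtain \<alpha> where \<alpha>: "x \<in> V0" "\<alpha> \<in> S" "x \<in> outer_box \<alpha>" by blast
    then have "\<forall>i<d. x i \<in> mspace (M i) \<and> (\<exists>z. z \<in> R \<alpha> i \<and> mdist (M i) (x i) z < q \<alpha> powr a i)"
      by (auto simp: outer_box_def PiE_iff nbhd_def)
    then obtain z where z: "\<And>i. i < d \<Longrightarrow> x i \<in> mspace (M i) \<and> z i \<in> R \<alpha> i \<and> mdist (M i) (x i) (z i) < q \<alpha> powr a i"
      by metis
    then have zZ: "z \<in> Z \<alpha>" using \<alpha> by (auto simp: Z_def)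
    obtain p where p: "p \<in> P" "q \<alpha> \<le> q (fst p)" "\<And>i. i < d \<Longrightarrow> mdist (M i) (z i) (snd p i) < 6 * q (fst p) powr a i"
      using P_cover[OF \<alpha>(2) zZ] by blast
    \<comment> \<open>The 7 is 6 + 1: z is within 6 sides of the selected centre, and x within one
      side of z, measured in the larger rectangle.\<close>
    have "x i \<in> mball_of (M i) (snd p i) (7 * \<sigma> p i)" if i: "i < d" for i
    proof -
      have "q \<alpha> powr a i \<le> \<sigma> p i"
        unfolding \<sigma>_def using p(2) Sq[OF \<alpha>(2)] a_pos[of i] by (intro powr_mono2) auto
      moreover have "mdist (M i) (snd p i) (x i) \<le> mdist (M i) (snd p i) (z i) + mdist (M i) (z i) (x i)"
        using z[OF i] Z_mem[OF \<alpha>(2) zZ i] PM[OF p(1) i] by (intro mdist_triangle) auto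
      ultimately show ?thesis
        using p(3)[OF i] z[OF i] PM[OF p(1) i] by (auto simp: \<sigma>_def mdist_commute)
    qed
    then have "x \<in> Q p" using \<alpha>(3) by (auto simp: Q_def outer_box_def PiE_iff)
    then show "x \<in> (\<Union>p\<in>P. Q p)" using p(1) by blast
  qed

  \<comment> \<open>The enlarged rectangles overlap; disjoint pieces prevent the same mass from
    being moved twice.\<close>
  obtain B where B: "\<And>p. p \<in> P \<Longrightarrow> B p \<in> sets Pm" "\<And>p. p \<in> P \<Longrightarrow> B p \<subseteq> Q p" "disjoint_family_on B P"
      "(\<Union>p\<in>P. B p) = (\<Union>p\<in>P. Q p)"
    using finite_disjoint_refinement[of P Q Pm] P(1) Q_sets by metis
  define w where "w p = measure \<nu> (B p) / measure Pm (core_box p)" for p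
  have core_pos: "measure Pm (core_box p) > 0" if "p \<in> P" for p
    unfolding measure_core_box
  proof (intro prod_pos ballI)
    fix i assume "i \<in> {..<d}"
    then show "0 < measure (m i) (core (fst p) (snd p) i)"
      using SJ[OF PS(1)[OF that]] Sq[OF PS(1)[OF that]] PR[OF that] S\<theta>[OF PS(1)[OF that], of i] \<theta> \<tau>(2)
      by (intro measure_core_pos) auto
  qed
  have w: "w p \<ge> 0" "w p * measure Pm (core_box p) = measure \<nu> (B p)" if "p \<in> P" for p
    using core_pos[OF that] by (auto simp: w_def)
  have \<nu>B: "measure \<nu> (B p) \<le> H1 * (\<Prod>i<d. q (fst p) powr (a i * \<delta> i))" if p: "p \<in> P" for p
  proof -
    have "measure \<nu> (B p) \<le> measure \<nu> (Q p)"
      using B(2)[OF p] Q_sets sets_\<nu> by (intro \<nu>.finite_measure_mono) auto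
    also have "\<dots> \<le> H * measure Pm (Q p)" using Q_sets by (rule H(2))
    also have "measure Pm (Q p) = (\<Prod>i<d. measure (m i) (mball_of (M i) (snd p i) (7 * \<sigma> p i)))"
      unfolding Q_def by (rule P.prob_times) auto
    also have "H * \<dots> \<le> H * (\<Prod>i<d. K * (7 * \<sigma> p i) powr \<delta> i)"
    proof (intro mult_left_mono prod_mono conjI H(1))
      fix i assume "i \<in> {..<d}"
      then show "measure (m i) (mball_of (M i) (snd p i) (7 * \<sigma> p i)) \<le> K * (7 * \<sigma> p i) powr \<delta> i"
        using PM[OF p, of i] \<sigma>[OF p, of i] \<theta> by (intro ball_upper) auto
    qed auto
    also have "(\<Prod>i<d. K * (7 * \<sigma> p i) powr \<delta> i) = (\<Prod>i<d. (K * 7 powr \<delta> i) * q (fst p) powr (a i * \<delta> i))"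
      using \<sigma>[OF p] by (intro prod.cong) (auto simp: powr_mult powr_powr \<sigma>_def)
    finally show ?thesis by (simp add: H1_def prod.distrib mult.assoc)
  qed

  \<comment> \<open>On each core box this is the product measure, scaled so that the box receives
    exactly the old mass of \<open>B p\<close>.\<close>
  define \<nu>' where "\<nu>' = density Pm (\<lambda>x. \<Sum>p\<in>P. ennreal (w p) * indicator (core_box p) x)"
  define V' where "V' = (\<Union>p\<in>P. core_box p)"
  have sets_\<nu>': "sets \<nu>' = sets Pm" by (simp add: \<nu>'_def)
  have em_\<nu>': "emeasure \<nu>' A = ennreal (\<Sum>p\<in>P. w p * measure Pm (A \<inter> core_box p))"
    if "A \<in> sets Pm" for A
    unfolding \<nu>'_def using w that by (intro emeasure_density_sum_indicator P.finite_measure_axioms) auto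
  have me_\<nu>': "measure \<nu>' A = (\<Sum>p\<in>P. w p * measure Pm (A \<inter> core_box p))" if "A \<in> sets Pm" for A
    unfolding measure_def em_\<nu>'[OF that] using w by (subst enn2real_ennreal) (auto intro!: sum_nonneg simp: measure_def)
  have fin_\<nu>': "finite_measure \<nu>'"
    using em_\<nu>'[of "space \<nu>'"] sets_\<nu>' by (intro finite_measureI) (auto simp: \<nu>'_def)
  have V'_sets: "V' \<in> sets Pm" using P(1) by (auto simp: V'_def)

  have mass: "measure \<nu> V - \<epsilon> \<le> measure \<nu>' V'"
  proof -
    define F where "F = (\<Union>\<alpha>\<in>S. outer_box \<alpha>)"
    have F: "F \<in> sets Pm" using S(1) by (auto simp: F_def)
    have UB: "(\<Union>p\<in>P. B p) \<in> sets Pm" using B(1) P(1) by auto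
    have "measure \<nu> V \<le> measure \<nu> ((\<Union>p\<in>P. B p) \<union> ((V - V0) \<union> (space Pm - F)))"
    proof (rule \<nu>.finite_measure_mono)
      show "V \<subseteq> (\<Union>p\<in>P. B p) \<union> ((V - V0) \<union> (space Pm - F))"
        using V0_cover sets.sets_into_space[OF V_sets] unfolding B(4) F_def by blast
      show "(\<Union>p\<in>P. B p) \<union> ((V - V0) \<union> (space Pm - F)) \<in> sets \<nu>"
        unfolding sets_\<nu> using UB V_sets V0(1) F by (intro sets.Un sets.Diff) auto
    qed
    also have "\<dots> \<le> measure \<nu> (\<Union>p\<in>P. B p) + measure \<nu> ((V - V0) \<union> (space Pm - F))"
      using UB V_sets V0 F by (intro measure_Un_le) (auto simp: sets_\<nu>)
    also have "measure \<nu> ((V - V0) \<union> (space Pm - F)) \<le> measure \<nu> (V - V0) + measure \<nu> (space Pm - F)"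
      using V_sets V0 F by (intro measure_Un_le) (auto simp: sets_\<nu>)
    also have "measure \<nu> (V - V0) \<le> H * measure Pm (V - V0)"
      using V_sets V0 by (intro H(2)) auto
    also have "\<dots> \<le> H * \<epsilon>'" using V0 H by (intro mult_left_mono) auto
    also have "measure \<nu> (space Pm - F) \<le> H * measure Pm (space Pm - F)"
      using F by (intro H(2)) auto
    also have "\<dots> \<le> H * \<epsilon>'" using S(3) H unfolding F_def by (intro mult_left_mono) auto
    also have "measure \<nu> (\<Union>p\<in>P. B p) = (\<Sum>p\<in>P. measure \<nu> (B p))"
      using B P(1) by (intro \<nu>.finite_measure_finite_Union) (auto simp: sets_\<nu>)
    also have "\<dots> = (\<Sum>p\<in>P. w p * measure Pm (V' \<inter> core_box p))"
    proof (rule sum.cong[OF refl])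
      fix p assume p: "p \<in> P"
      then have "V' \<inter> core_box p = core_box p" by (auto simp: V'_def)
      then show "measure \<nu> (B p) = w p * measure Pm (V' \<inter> core_box p)" using w p by simp
    qed
    also have "\<dots> = measure \<nu>' V'" using V'_sets by (simp add: me_\<nu>')
    finally show ?thesis using \<epsilon>'(2) by simp
  qed

  have abs_cont: "\<exists>H\<ge>0. \<forall>A\<in>sets Pm. measure \<nu>' A \<le> H * measure Pm A"
  proof (intro exI[of _ "\<Sum>p\<in>P. w p"] conjI ballI)
    fix A assume A: "A \<in> sets Pm"
    have "measure \<nu>' A \<le> (\<Sum>p\<in>P. w p * measure Pm A)"
      unfolding me_\<nu>'[OF A] using w A by (intro sum_mono mult_left_mono P.finite_measure_mono) auto
    then show "measure \<nu>' A \<le> (\<Sum>p\<in>P. w p) * measure Pm A" by (simp add: sum_distrib_right)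
  qed (use w in \<open>auto intro!: sum_nonneg\<close>)

  have outside: "measure \<nu>' (space Pm - V') = 0"
  proof -
    have "(space Pm - V') \<inter> core_box p = {}" if "p \<in> P" for p using that by (auto simp: V'_def)
    then show ?thesis using V'_sets by (simp add: me_\<nu>')
  qed

  have balls: "measure \<nu>' (pball x r) \<le> C' * r powr s" if x: "x \<in> space Pm" and r: "r > 0" for x r
  proof (cases "r \<le> rs")
    case True
    have "measure \<nu>' (pball x r) = (\<Sum>p\<in>P. w p * measure Pm (pball x r \<inter> core_box p))"
      by (rule me_\<nu>') simp
    also have "\<dots> \<le> 2 ^ d * (H1 * (\<Prod>i<d. coord_const i) * r powr D)"
      unfolding D_def
    proof (rule small_ball_estimate[OF P(1,3)])
      fix p i assume "p \<in> P" "i < d"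
      then show "fst p \<in> J \<and> q (fst p) < 1 \<and> snd p i \<in> R (fst p) i \<and> q (fst p) powr a i \<le> r0"
        using PS[of p] SJ[of "fst p"] Sq[of "fst p"] \<tau>(2) PR[of p i] S\<theta>[of "fst p" i] \<theta> by auto
    next
      fix p assume "p \<in> P"
      then show "0 \<le> w p \<and> w p * measure Pm (core_box p) \<le> H1 * (\<Prod>i<d. q (fst p) powr (a i * \<delta> i))"
        using w \<nu>B by simp
    qed (use H1 x r True rs in auto)
    also have "\<dots> \<le> L * r powr D"
      by (simp add: L_def algebra_simps)
    also have "\<dots> \<le> C' * r powr s" using small r True by simp
    finally show ?thesis .
  next
    case False
    \<comment> \<open>The mass of a core that meets the ball came from a piece at most
      \<open>gap\<close> further out, so the old bound at radius r + gap applies.\<close>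
    define PH where "PH = {p\<in>P. pball x r \<inter> core_box p \<noteq> {}}"
    have PH: "finite PH" "PH \<subseteq> P" using P(1) by (auto simp: PH_def)
    have "measure \<nu>' (pball x r) = (\<Sum>p\<in>P. w p * measure Pm (pball x r \<inter> core_box p))"
      by (rule me_\<nu>') simp
    also have "\<dots> = (\<Sum>p\<in>PH. w p * measure Pm (pball x r \<inter> core_box p))"
      using P(1) by (intro sum.mono_neutral_right) (auto simp: PH_def)
    also have "\<dots> \<le> (\<Sum>p\<in>PH. w p * measure Pm (core_box p))"
      using w PH by (intro sum_mono mult_left_mono P.finite_measure_mono) auto
    also have "\<dots> = (\<Sum>p\<in>PH. measure \<nu> (B p))"
      using w PH by (intro sum.cong) auto
    also have "\<dots> = measure \<nu> (\<Union>p\<in>PH. B p)"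
      using B(1) PH disjoint_family_on_mono[OF PH(2) B(3)]
      by (intro \<nu>.finite_measure_finite_Union[symmetric]) (auto simp: sets_\<nu>)
    also have "\<dots> \<le> measure \<nu> (pball x (r + gap))"
    proof (rule \<nu>.finite_measure_mono)
      show "(\<Union>p\<in>PH. B p) \<subseteq> pball x (r + gap)"
      proof (intro UN_least subsetI)
        fix p y assume p: "p \<in> PH" and "y \<in> B p"
        then have pP: "p \<in> P" and y: "y \<in> Q p" using PH(2) B(2)[of p] by blast+
        obtain v where v: "v \<in> pball x r" "v \<in> core_box p" using p by (auto simp: PH_def)
        have "y i \<in> mball_of (M i) (x i) (r + gap)" if i: "i < d" for i
        proof -
          have vi: "v i \<in> mball_of (M i) (x i) r" "v i \<in> mball_of (M i) (snd p i) (\<sigma> p i)"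
            and yi: "y i \<in> mball_of (M i) (snd p i) (7 * \<sigma> p i)"
            using v y i by (auto simp: pball_def core_box_def core_def Q_def \<sigma>_def PiE_iff)
          have "mdist (M i) (x i) (y i) \<le> mdist (M i) (x i) (v i) + mdist (M i) (v i) (y i)"
            using vi yi by (intro mdist_triangle) auto
          also have "mdist (M i) (v i) (y i) \<le> mdist (M i) (v i) (snd p i) + mdist (M i) (snd p i) (y i)"
            using vi yi by (intro mdist_triangle) auto
          finally have "mdist (M i) (x i) (y i) < r + 8 * \<sigma> p i"
            using vi yi by (auto simp: mdist_commute)
          also have "\<dots> \<le> r + gap" using \<sigma>[OF pP i] \<theta> by simp
          finally show ?thesis using vi yi by auto
        qed
        then show "y \<in> pball x (r + gap)"
          using y by (auto simp: pball_def Q_def PiE_iff)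
      qed
    qed (simp add: sets_\<nu>)
    also have "\<dots> \<le> C * (r + gap) powr s"
      using x r gap by (intro \<nu>_ball) auto
    also have "\<dots> \<le> C * (\<Lambda> * r) powr s"
    proof (intro mult_left_mono powr_mono2)
      have "(\<Lambda> - 1) * rs \<le> (\<Lambda> - 1) * r" using False \<Lambda> by (intro mult_left_mono) auto
      then show "r + gap \<le> \<Lambda> * r" by (simp add: gap_def algebra_simps)
    qed (use r gap s C in auto)
    also have "\<dots> = C' * r powr s" using \<Lambda> r by (simp add: powr_mult flip: \<Lambda>s)
    finally show ?thesis .
  qed

  \<comment> \<open>A point of a core is within two sides of a point of \<open>V0\<close>, and two
    sides are at most \<eta> / 4, so half of the margin remains.\<close>
  have inside: "pball y (\<eta> / 2) \<subseteq> V" if y: "y \<in> V'" for y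
  proof -
    obtain p where p: "p \<in> P" "y \<in> core_box p" using y by (auto simp: V'_def)
    then obtain x where x: "x \<in> V0" "\<And>i. i < d \<Longrightarrow> mdist (M i) (x i) (snd p i) < \<sigma> p i"
      using PS[of p] by (auto simp: Z_def \<sigma>_def)
    have "x \<in> space Pm" using x(1) V0(1) sets.sets_into_space by blast
    then have xi: "x i \<in> mspace (M i)" if "i < d" for i using that by (auto simp: space_Pm PiE_iff)
    have "pball y (\<eta> / 2) \<subseteq> pball x \<eta>"
      unfolding pball_def
    proof (intro PiE_mono mball_of_subset_mball_of)
      fix i assume "i \<in> {..<d}"
      then have i: "i < d" by simp
      show "x i \<in> mspace (M i)" by (rule xi[OF i])
      have yi: "y i \<in> mball_of (M i) (snd p i) (\<sigma> p i)"
        using p i by (auto simp: core_box_def core_def \<sigma>_def PiE_iff)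
      have "mdist (M i) (y i) (x i) \<le> mdist (M i) (y i) (snd p i) + mdist (M i) (snd p i) (x i)"
        using yi xi[OF i] by (intro mdist_triangle) auto
      then show "mdist (M i) (y i) (x i) + \<eta> / 2 \<le> \<eta>"
        using yi x(2)[OF i] \<sigma>[OF p(1) i] \<theta> by (auto simp: mdist_commute)
    qed
    then show ?thesis using V0(5) x(1) by blast
  qed
  have core_space: "core_box p \<subseteq> space Pm" for p
    by (rule sets.sets_into_space) simp
  have "V' \<subseteq> V"
  proof
    fix y assume y: "y \<in> V'"
    then have "y \<in> space Pm" using core_space by (auto simp: V'_def)
    then have "y \<in> pball y (\<eta> / 2)"
      using V0(2) by (auto simp: space_Pm pball_def PiE_iff mdist_self)
    then show "y \<in> V" using inside[OF y] by blast
  qed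
  moreover have "V' \<subseteq> (\<Union>\<alpha>\<in>S. target_box \<alpha>)"
    using PS(1) unfolding V'_def core_box_def target_box_def core_def by (fastforce simp: PiE_iff)
  moreover have "approx_inside V'"
    unfolding V'_def core_box_def using P(1) openin_core by (intro approx_inside_UN approx_inside_box) auto
  moreover have "spread s C' \<nu>' V'"
    unfolding spread_def using sets_\<nu>' fin_\<nu>' abs_cont outside balls \<open>approx_inside V'\<close> by blast
  moreover have "S \<inter> S0 = {}" "S \<subseteq> J" using S(2) by auto
  moreover have "\<eta> / 2 > 0" using V0(2) by simp
  ultimately show ?thesis
    using mass S(1) inside
    by (intro exI[of _ \<nu>'] exI[of _ V'] exI[of _ S] exI[of _ "\<eta> / 2"] conjI ballI)
qed

end

subsection \<open>Iteration and the mass distribution principle\<close>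

text \<open>Subsequences are extracted one coordinate after the other; phrasing convergence through
  \<open>mdist\<close> in each coordinate avoids a topology on the product.\<close>

lemma compact_boxes_subsequence:
  fixes y :: "nat \<Rightarrow> nat \<Rightarrow> 'a"
  assumes "\<And>i. i < d \<Longrightarrow> compactin (mtopology_of (M i)) (K i)" "\<And>n i. i < d \<Longrightarrow> y n i \<in> K i"
  shows "\<exists>(\<phi> :: nat \<Rightarrow> nat) l. strict_mono \<phi> \<and> (\<forall>i<d. l i \<in> mspace (M i)) \<and>
    (\<forall>e>0. \<exists>N. \<forall>n\<ge>N. \<forall>i<d. mdist (M i) (y (\<phi> n) i) (l i) < e)"
  using assms
proof (induction d)
  case 0
  show ?case by (rule exI[where x = "\<lambda>n. n"]) (simp add: strict_mono_def)
next
  case (Suc d)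
  have "\<exists>(\<phi> :: nat \<Rightarrow> nat) l. strict_mono \<phi> \<and> (\<forall>i<d. l i \<in> mspace (M i)) \<and>
      (\<forall>e>0. \<exists>N. \<forall>n\<ge>N. \<forall>i<d. mdist (M i) (y (\<phi> n) i) (l i) < e)"
  proof (rule Suc.IH)
    show "compactin (mtopology_of (M i)) (K i)" if "i < d" for i using Suc.prems(1)[of i] that by simp
    show "y n i \<in> K i" if "i < d" for n i using Suc.prems(2)[of i n] that by simp
  qed
  then obtain \<phi> :: "nat \<Rightarrow> nat" and l where \<phi>: "strict_mono \<phi>" and l: "\<And>i. i < d \<Longrightarrow> l i \<in> mspace (M i)"
    and conv: "\<And>e. e > 0 \<Longrightarrow> \<exists>N. \<forall>n\<ge>N. \<forall>i<d. mdist (M i) (y (\<phi> n) i) (l i) < e"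
    by blast
  have K: "compactin (Metric_space.mtopology (mspace (M d)) (mdist (M d))) (K d)"
    using Suc.prems(1)[of d] by (simp add: mtopology_of_def)
  have "range (\<lambda>n. y (\<phi> n) d) \<subseteq> K d" using Suc.prems(2) by auto
  then obtain b \<psi> where \<psi>: "strict_mono \<psi>" and b: "b \<in> K d"
    and lim: "limitin (Metric_space.mtopology (mspace (M d)) (mdist (M d))) ((\<lambda>n. y (\<phi> n) d) \<circ> \<psi>) b sequentially"
    using K unfolding Metric_space.compactin_sequentially[OF Metric_space_mspace_mdist] by blast
  have bM: "b \<in> mspace (M d)"
    using lim by (simp add: Metric_space.limitin_metric[OF Metric_space_mspace_mdist])
  have lim': "\<exists>N. \<forall>n\<ge>N. mdist (M d) (y (\<phi> (\<psi> n)) d) b < e" if "e > 0" for e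
    using lim that
    by (simp add: Metric_space.limitin_metric[OF Metric_space_mspace_mdist] eventually_sequentially) blast
  show ?case
  proof (intro exI[of _ "\<phi> \<circ> \<psi>"] exI[of _ "l(d := b)"] conjI allI impI)
    show "strict_mono (\<phi> \<circ> \<psi>)" using \<phi> \<psi> by (rule strict_mono_o)
    show "(l(d := b)) i \<in> mspace (M i)" if "i < Suc d" for i
      using that l bM by (auto simp: less_Suc_eq)
    fix e :: real assume "e > 0"
    obtain N1 where N1: "\<And>n i. n \<ge> N1 \<Longrightarrow> i < d \<Longrightarrow> mdist (M i) (y (\<phi> n) i) (l i) < e"
      using conv[OF \<open>e > 0\<close>] by blast
    obtain N2 where N2: "\<And>n. n \<ge> N2 \<Longrightarrow> mdist (M d) (y (\<phi> (\<psi> n)) d) b < e"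
      using lim'[OF \<open>e > 0\<close>] by blast
    have "mdist (M i) (y ((\<phi> \<circ> \<psi>) n) i) ((l(d := b)) i) < e" if "n \<ge> max N1 N2" "i < Suc d" for n i
    proof (cases "i = d")
      case True
      then show ?thesis using N2 that by simp
    next
      case False
      have "\<psi> n \<ge> N1" using that seq_suble[OF \<psi>, of n] by simp
      then show ?thesis using N1 that False by (auto simp: less_Suc_eq)
    qed
    then show "\<exists>N. \<forall>n\<ge>N. \<forall>i<Suc d. mdist (M i) (y ((\<phi> \<circ> \<psi>) n) i) ((l(d := b)) i) < e"
      by blast
  qed
qed

lemma mdist_le_prod_dist: "i < d \<Longrightarrow> mdist (M i) (x i) (y i) \<le> prod_dist d M x y"
  unfolding prod_dist_def by (intro Max_ge) auto

context resonant_system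
begin

definition limsup_set :: "(nat \<Rightarrow> 'a) set" where
  "limsup_set = {x \<in> PiE {..<d} (\<lambda>i. mspace (M i)).
     infinite {\<alpha>\<in>J. \<forall>i<d. x i \<in> nbhd (M i) (R \<alpha> i) (q \<alpha> powr (a i + t i))}}"

text \<open>The auxiliary sets \<open>F n\<close> collect all indices used so far, and each round
  avoids them. A point of all \<open>V n\<close> thus lies in target boxes of infinitely many
  distinct indices.\<close>

lemma ex_nested_masses:
  assumes start: "spread s C \<nu>0 V0" "C > 0" "measure \<nu>0 V0 > 0"
    and s: "0 < s" "s < dimnum d \<delta> \<kappa> a t"
  shows "\<exists>\<nu> V. V 0 = V0 \<and> (\<forall>n. spread s (2 * C) (\<nu> n) (V n)) \<and>
    (\<forall>n. measure \<nu>0 V0 / 2 \<le> measure (\<nu> n) (V n)) \<and>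
    (\<forall>n. V (Suc n) \<subseteq> V n \<and> (\<exists>\<eta>>0. \<forall>x\<in>V (Suc n). pball x \<eta> \<subseteq> V n)) \<and> (\<Inter>n. V n) \<subseteq> limsup_set"
proof -
  define c0 where "c0 = measure \<nu>0 V0"
  \<comment> \<open>\<open>Cn\<close> increases strictly from C towards 2 * C and \<open>cn\<close>
    decreases strictly from c0 towards c0 / 2; each step leaves room for one transfer.\<close>
  define Cn where "Cn n = C * (2 - (1 / 2) ^ n)" for n :: nat
  define cn where "cn n = c0 * (1 / 2 + (1 / 2) ^ Suc n)" for n :: nat
  define good where "good n p \<longleftrightarrow> (case p of (\<nu>, V, F) \<Rightarrow>
      spread s (Cn n) \<nu> V \<and> cn n \<le> measure \<nu> V \<and> finite F \<and> F \<subseteq> J \<and> (n = 0 \<longrightarrow> V = V0))"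
    for n :: nat and p :: "(nat \<Rightarrow> 'a) measure \<times> (nat \<Rightarrow> 'a) set \<times> 'j set"
  define step where "step p p' \<longleftrightarrow> (case p of (\<nu>, V, F) \<Rightarrow> case p' of (\<nu>', V', F') \<Rightarrow>
      F \<subseteq> F' \<and> V' \<subseteq> (\<Union>\<alpha>\<in>F' - F. target_box \<alpha>) \<and> V' \<subseteq> V \<and> (\<exists>\<eta>>0. \<forall>x\<in>V'. pball x \<eta> \<subseteq> V))"
    for p p' :: "(nat \<Rightarrow> 'a) measure \<times> (nat \<Rightarrow> 'a) set \<times> 'j set"
  have "\<exists>f. \<forall>n. good n (f n) \<and> step (f n) (f (Suc n))"
  proof (rule dependent_nat_choice)
    show "\<exists>p. good 0 p"
      using start by (intro exI[of _ "(\<nu>0, V0, {})"]) (simp add: good_def Cn_def cn_def c0_def)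
    fix p n assume "good n p"
    obtain \<nu> V F where p: "p = (\<nu>, V, F)" by (cases p)
    have g: "spread s (Cn n) \<nu> V" "cn n \<le> measure \<nu> V" "finite F" "F \<subseteq> J"
      using \<open>good n p\<close> by (auto simp: good_def p)
    have C: "0 < Cn n" "Cn n < Cn (Suc n)"
    proof -
      have "(1 / 2 :: real) ^ n \<le> 1" by (simp add: power_le_one)
      then show "0 < Cn n" using start(2) by (simp add: Cn_def)
      show "Cn n < Cn (Suc n)" using start(2) by (simp add: Cn_def)
    qed
    have "cn n - cn (Suc n) > 0" using start(3) by (simp add: cn_def c0_def algebra_simps)
    from ex_mass_transfer[OF g(1) C s this g(3)] obtain \<nu>' V' S \<eta> where
      n: "spread s (Cn (Suc n)) \<nu>' V'" "measure \<nu> V - (cn n - cn (Suc n)) \<le> measure \<nu>' V'"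
        "finite S" "S \<inter> F = {}" "S \<subseteq> J" "V' \<subseteq> (\<Union>\<alpha>\<in>S. target_box \<alpha>)" "V' \<subseteq> V" "\<eta> > 0"
        "\<forall>x\<in>V'. pball x \<eta> \<subseteq> V"
      by (elim exE conjE)
    have "(F \<union> S) - F = S" using n(4) by blast
    then have "step p (\<nu>', V', F \<union> S)"
      using n unfolding step_def p by auto
    moreover have "good (Suc n) (\<nu>', V', F \<union> S)"
      using n g unfolding good_def by auto
    ultimately show "\<exists>p'. good (Suc n) p' \<and> step p p'" by blast
  qed
  then obtain f where f: "\<And>n. good n (f n)" "\<And>n. step (f n) (f (Suc n))" by blast
  define \<nu> V F where "\<nu> n = fst (f n)" and "V n = fst (snd (f n))" and "F n = snd (snd (f n))" for n
  have fn: "f n = (\<nu> n, V n, F n)" for n by (simp add: \<nu>_def V_def F_def)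
  have good: "spread s (Cn n) (\<nu> n) (V n)" "cn n \<le> measure (\<nu> n) (V n)" "finite (F n)" "F n \<subseteq> J" for n
    using f(1)[of n] by (auto simp: good_def fn)
  have V_0: "V 0 = V0" using f(1)[of 0] by (auto simp: good_def fn)
  have step: "F n \<subseteq> F (Suc n)" "V (Suc n) \<subseteq> (\<Union>\<alpha>\<in>F (Suc n) - F n. target_box \<alpha>)" "V (Suc n) \<subseteq> V n"
    "\<exists>\<eta>>0. \<forall>x\<in>V (Suc n). pball x \<eta> \<subseteq> V n" for n
    using f(2)[of n] by (auto simp: step_def fn)
  have F_mono: "F k \<subseteq> F n" if "k \<le> n" for k n using step(1) that by (rule lift_Suc_mono_le)
  have "(\<Inter>n. V n) \<subseteq> limsup_set"
  proof
    fix x assume x: "x \<in> (\<Inter>n. V n)"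
    have "\<exists>\<alpha>. \<alpha> \<in> F (Suc n) - F n \<and> x \<in> target_box \<alpha>" for n
      using x step(2)[of n] by blast
    then obtain \<alpha> where \<alpha>: "\<And>n. \<alpha> n \<in> F (Suc n) - F n" "\<And>n. x \<in> target_box (\<alpha> n)" by metis
    have "\<alpha> k \<noteq> \<alpha> n" if "k < n" for k n
      using \<alpha>(1)[of k] \<alpha>(1)[of n] F_mono[of "Suc k" n] that by auto
    then have "inj \<alpha>" by (metis injI nat_neq_iff)
    then have "infinite (range \<alpha>)" by (rule range_inj_infinite)
    moreover have "range \<alpha> \<subseteq> {\<alpha>\<in>J. \<forall>i<d. x i \<in> nbhd (M i) (R \<alpha> i) (q \<alpha> powr (a i + t i))}"
      using \<alpha> good(4) by (force simp: target_box_def PiE_iff)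
    ultimately have "infinite {\<alpha>\<in>J. \<forall>i<d. x i \<in> nbhd (M i) (R \<alpha> i) (q \<alpha> powr (a i + t i))}"
      using finite_subset by blast
    moreover have "x \<in> PiE {..<d} (\<lambda>i. mspace (M i))"
      using \<alpha>(2)[of 0] by (auto simp: target_box_def PiE_iff nbhd_def)
    ultimately show "x \<in> limsup_set" by (simp add: limsup_set_def)
  qed
  moreover have "spread s (2 * C) (\<nu> n) (V n)" for n
  proof -
    have "Cn n \<le> 2 * C" using start(2) by (simp add: Cn_def)
    then have "Cn n * r powr s \<le> 2 * C * r powr s" for r by (intro mult_right_mono) auto
    then show ?thesis using good(1)[of n] unfolding spread_def by (meson order_trans)
  qed
  moreover have "measure \<nu>0 V0 / 2 \<le> measure (\<nu> n) (V n)" for n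
  proof -
    have "c0 / 2 \<le> cn n" using start(3) by (simp add: cn_def c0_def algebra_simps)
    then show ?thesis using good(2)[of n] by (simp add: c0_def)
  qed
  ultimately show ?thesis
    using V_0 step(3,4) by (intro exI[of _ \<nu>] exI[of _ V] conjI allI)
qed

section \<open>Covers of the limit set\<close>

text \<open>The \<open>V n\<close> need not be closed, yet a limit of points y n in
  \<open>V n\<close> belongs to each of them: late points lie in \<open>V (Suc n)\<close> and come
  closer to the limit than the margin. If each y n avoided the first n balls, the limit would lie in
  some open ball k, and so would late points, with index at least k.\<close>

lemma nested_ball_cover:
  assumes K: "\<And>i. i < d \<Longrightarrow> compactin (mtopology_of (M i)) (B i)" "V 0 \<subseteq> PiE {..<d} B"
    and V: "\<And>n. V (Suc n) \<subseteq> V n" "\<And>n. \<exists>\<eta>>0. \<forall>x\<in>V (Suc n). pball x \<eta> \<subseteq> V n"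
    and cover: "(\<Inter>n. V n) \<subseteq> (\<Union>k. pball (x k) (r k))"
  shows "\<exists>n. V n \<subseteq> (\<Union>k\<le>n. pball (x k) (r k))"
proof (rule ccontr)
  assume "\<not> ?thesis"
  then have "\<exists>y. y \<in> V n \<and> y \<notin> (\<Union>k\<le>n. pball (x k) (r k))" for n by blast
  then obtain y where y: "\<And>n. y n \<in> V n" "\<And>n. y n \<notin> (\<Union>k\<le>n. pball (x k) (r k))" by metis
  have V_mono: "V n \<subseteq> V k" if "k \<le> n" for k n using V(1) that by (rule lift_Suc_antimono_le)
  have yK: "y n i \<in> B i" if "i < d" for n i
    using y(1)[of n] V_mono[of 0 n] K(2) that by (auto simp: PiE_iff)
  obtain \<phi> :: "nat \<Rightarrow> nat" and l where \<phi>: "strict_mono \<phi>" and l: "\<And>i. i < d \<Longrightarrow> l i \<in> mspace (M i)"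
    and conv: "\<And>e. e > 0 \<Longrightarrow> \<exists>N. \<forall>n\<ge>N. \<forall>i<d. mdist (M i) (y (\<phi> n) i) (l i) < e"
    using compact_boxes_subsequence[of d M B y] K(1) yK by metis
  define z where "z = restrict l {..<d}"
  have K_space: "B i \<subseteq> mspace (M i)" if "i < d" for i
    using compactin_subset_topspace[OF K(1)[OF that]] by simp
  have y_space: "y n i \<in> mspace (M i)" if "i < d" for n i using yK[OF that] K_space[OF that] by auto
  have "z \<in> V n" for n
  proof -
    obtain \<eta> where \<eta>: "\<eta> > 0" "\<forall>x\<in>V (Suc n). pball x \<eta> \<subseteq> V n" using V(2) by blast
    obtain N where N: "\<And>k i. k \<ge> N \<Longrightarrow> i < d \<Longrightarrow> mdist (M i) (y (\<phi> k) i) (l i) < \<eta>"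
      using conv[OF \<eta>(1)] by blast
    define k where "k = max N (Suc n)"
    have "y (\<phi> k) \<in> V (Suc n)"
      using y(1)[of "\<phi> k"] V_mono[of "Suc n" "\<phi> k"] seq_suble[OF \<phi>, of k] by (auto simp: k_def)
    moreover have "z \<in> pball (y (\<phi> k)) \<eta>"
      using N[of k] l y_space by (auto simp: pball_def z_def k_def PiE_iff)
    ultimately show ?thesis using \<eta>(2) by blast
  qed
  then obtain k where k: "z \<in> pball (x k) (r k)" using cover by blast
  define e where "e = Min ((\<lambda>i. r k - mdist (M i) (x k i) (l i)) ` {..<d})"
  have ne: "{..<d} \<noteq> {}" using d_pos by (simp add: lessThan_empty_iff)
  have zk: "mdist (M i) (x k i) (l i) < r k" "x k i \<in> mspace (M i)" if "i < d" for i
    using k that by (auto simp: pball_def z_def PiE_iff)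
  have e: "e > 0" "\<And>i. i < d \<Longrightarrow> mdist (M i) (x k i) (l i) + e \<le> r k"
  proof -
    show "e > 0" unfolding e_def using ne zk(1) by (subst Min_gr_iff) auto
    show "mdist (M i) (x k i) (l i) + e \<le> r k" if "i < d" for i
    proof -
      have "e \<le> r k - mdist (M i) (x k i) (l i)" unfolding e_def using that by (intro Min_le) auto
      then show ?thesis by simp
    qed
  qed
  obtain N where N: "\<And>n i. n \<ge> N \<Longrightarrow> i < d \<Longrightarrow> mdist (M i) (y (\<phi> n) i) (l i) < e"
    using conv[OF e(1)] by blast
  define n where "n = max N k"
  have "y (\<phi> n) i \<in> mball_of (M i) (x k i) (r k)" if i: "i < d" for i
  proof -
    have "mdist (M i) (x k i) (y (\<phi> n) i) \<le> mdist (M i) (x k i) (l i) + mdist (M i) (l i) (y (\<phi> n) i)"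
      using l[OF i] y_space[OF i] zk(2)[OF i] by (intro mdist_triangle)
    then show ?thesis
      using N[of n i] e(2)[OF i] i y_space[OF i] zk(2)[OF i] by (auto simp: n_def mdist_commute)
  qed
  moreover have "y (\<phi> n) \<in> extensional {..<d}"
    using y(1)[of "\<phi> n"] V_mono[of 0 "\<phi> n"] K(2) by (auto simp: PiE_iff)
  ultimately have "y (\<phi> n) \<in> pball (x k) (r k)" by (auto simp: pball_def PiE_iff)
  moreover have "k \<le> \<phi> n" using seq_suble[OF \<phi>, of n] by (simp add: n_def)
  ultimately show False using y(2)[of "\<phi> n"] by blast
qed

text \<open>The distance bound 1 makes the real suprema genuine ones; strictness in \<open>r\<close>
  is needed because the balls are open.\<close>

lemma bounded_cover_subset_pball:
  assumes "U \<subseteq> space Pm" "\<forall>x\<in>U. \<forall>y\<in>U. prod_dist d M x y \<le> 1" "x \<in> U"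
    and r: "(SUP x\<in>U. SUP y\<in>U. prod_dist d M x y) < r"
  shows "U \<subseteq> pball x r"
proof
  fix y assume y: "y \<in> U"
  have bdd: "bdd_above (prod_dist d M x ` U)" if "x \<in> U" for x
    using assms(2) that by (intro bdd_aboveI[of _ 1]) auto
  have "prod_dist d M x y \<le> (SUP y\<in>U. prod_dist d M x y)"
    using y bdd[OF assms(3)] by (intro cSUP_upper) auto
  also have "\<dots> \<le> (SUP x\<in>U. SUP y\<in>U. prod_dist d M x y)"
  proof (rule cSUP_upper[OF assms(3)])
    show "bdd_above ((\<lambda>x. SUP y\<in>U. prod_dist d M x y) ` U)"
      using assms(2) y by (intro bdd_aboveI[of _ 1]) (auto intro!: cSUP_least)
  qed
  finally have "mdist (M i) (x i) (y i) < r" if "i < d" for i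
    using r mdist_le_prod_dist[OF that, of M x y] by linarith
  then show "y \<in> pball x r"
    using y assms(1,3) by (auto simp: pball_def space_Pm PiE_iff subset_iff)
qed

lemma hausdorff_measure_limsup_set_pos:
  assumes start: "spread s C \<nu>0 V0" "C > 0" "measure \<nu>0 V0 > 0"
    and K: "\<And>i. i < d \<Longrightarrow> compactin (mtopology_of (M i)) (B i)" "V0 \<subseteq> PiE {..<d} B"
    and s: "0 < s" "s < dimnum d \<delta> \<kappa> a t"
  shows "hausdorff_measure (PiE {..<d} (\<lambda>i. mspace (M i))) (prod_dist d M) s limsup_set \<noteq> 0"
proof
  assume zero: "hausdorff_measure (PiE {..<d} (\<lambda>i. mspace (M i))) (prod_dist d M) s limsup_set = 0"
  obtain \<nu> V where V0: "V 0 = V0" and spr: "\<And>n. spread s (2 * C) (\<nu> n) (V n)"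
    and mass: "\<And>n. measure \<nu>0 V0 / 2 \<le> measure (\<nu> n) (V n)"
    and nest: "\<And>n. V (Suc n) \<subseteq> V n" "\<And>n. \<exists>\<eta>>0. \<forall>x\<in>V (Suc n). pball x \<eta> \<subseteq> V n"
    and lim: "(\<Inter>n. V n) \<subseteq> limsup_set"
    using ex_nested_masses[OF start s] by metis
  define c where "c = measure \<nu>0 V0 / 2"
  \<comment> \<open>The balls will carry at most 2 * C * (\<epsilon> + \<epsilon>) = c / 2, half of
    the mass they cover.\<close>
  define \<epsilon> where "\<epsilon> = c / (8 * C)"
  have c: "c > 0" and \<epsilon>: "\<epsilon> > 0" using start by (auto simp: c_def \<epsilon>_def)
  define diam where "diam U = (SUP x\<in>U. SUP y\<in>U. prod_dist d M x y)" for U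
  define g where "g U = (if U = {} then 0 else diam U powr s)" for U
  have "\<exists>U. limsup_set \<subseteq> (\<Union>n. U n) \<and> (\<forall>n. U n \<subseteq> space Pm \<and> (\<forall>x\<in>U n. \<forall>y\<in>U n. prod_dist d M x y \<le> 1))
      \<and> (\<Sum>n. ennreal (g (U n))) < ennreal \<epsilon>"
  proof -
    \<comment> \<open>Covers by sets of diameter at most 1 suffice: if the supremum over all meshes
      is 0, so is its term at mesh 1.\<close>
    have "(INF U \<in> {U :: nat \<Rightarrow> (nat \<Rightarrow> 'a) set. limsup_set \<subseteq> (\<Union>n. U n) \<and>
            (\<forall>n. U n \<subseteq> space Pm \<and> (\<forall>x\<in>U n. \<forall>y\<in>U n. prod_dist d M x y \<le> 1))}.
          (\<Sum>n. ennreal (g (U n)))) \<le> 0"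
      unfolding zero[symmetric] hausdorff_measure_def g_def diam_def space_Pm
      by (rule SUP_upper) auto
    also have "0 < ennreal \<epsilon>" using \<epsilon> by simp
    finally show ?thesis unfolding INF_less_iff by blast
  qed
  then obtain U where U: "limsup_set \<subseteq> (\<Union>n. U n)" "\<And>n. U n \<subseteq> space Pm"
      "\<And>n. \<forall>x\<in>U n. \<forall>y\<in>U n. prod_dist d M x y \<le> 1" "(\<Sum>n. ennreal (g (U n))) < ennreal \<epsilon>"
    by blast
  obtain x0 where x0: "x0 \<in> space Pm" using P.not_empty by blast
  define x where "x k = (if U k = {} then x0 else SOME x. x \<in> U k)" for k
  \<comment> \<open>The extra summand makes the radius exceed the diameter, also for empty and
    one-point sets, at a total cost of \<epsilon>.\<close>
  define r where "r k = (g (U k) + \<epsilon> * (1 / 2) ^ Suc k) powr (1 / s)" for k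
  have g: "g A \<ge> 0" for A by (simp add: g_def)
  have x_mem: "x k \<in> U k" if "U k \<noteq> {}" for k
    using that by (simp add: x_def some_in_eq)
  have x_space: "x k \<in> space Pm" for k
    using x_mem[of k] U(2)[of k] x0 by (cases "U k = {}") (auto simp: x_def)
  have rs: "r k powr s = g (U k) + \<epsilon> * (1 / 2) ^ Suc k" and r_pos: "r k > 0" for k
  proof -
    have "g (U k) + \<epsilon> * (1 / 2) ^ Suc k > 0" using g \<epsilon> by (intro add_nonneg_pos) auto
    then show "r k powr s = g (U k) + \<epsilon> * (1 / 2) ^ Suc k" "r k > 0"
      unfolding r_def using s by (simp_all add: powr_powr)
  qed
  have U_ball: "U k \<subseteq> pball (x k) (r k)" for k
  proof (cases "U k = {}")
    case False
    have "diam (U k) < r k"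
    proof (rule ccontr)
      assume "\<not> diam (U k) < r k"
      then have "r k powr s \<le> diam (U k) powr s" using r_pos[of k] s by (intro powr_mono2) auto
      then have "\<epsilon> * (1 / 2) ^ Suc k \<le> 0" using rs[of k] False by (simp add: g_def)
      moreover have "\<epsilon> * (1 / 2) ^ Suc k > 0" using \<epsilon> by simp
      ultimately show False by linarith
    qed
    then show ?thesis
      using U(2,3) x_mem[OF False] unfolding diam_def by (intro bounded_cover_subset_pball)
  qed simp
  have "(\<Union>k. U k) \<subseteq> (\<Union>k. pball (x k) (r k))" by (rule UN_mono[OF order_refl U_ball])
  then have "(\<Inter>n. V n) \<subseteq> (\<Union>k. pball (x k) (r k))"
    by (rule order_trans[OF order_trans[OF lim U(1)]])
  then have "\<exists>n. V n \<subseteq> (\<Union>k\<le>n. pball (x k) (r k))"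
    using K V0 nest by (intro nested_ball_cover[where B = B]) simp_all
  then obtain n where n: "V n \<subseteq> (\<Union>k\<le>n. pball (x k) (r k))" ..
  interpret \<nu>: finite_measure "\<nu> n" using spr[of n] by (simp add: spread_def)
  have sets_\<nu>: "sets (\<nu> n) = sets Pm" using spr[of n] by (simp add: spread_def)
  have "c \<le> measure (\<nu> n) (V n)" using mass by (simp add: c_def)
  also have "\<dots> \<le> measure (\<nu> n) (\<Union>k\<le>n. pball (x k) (r k))"
    using n by (intro \<nu>.finite_measure_mono) (auto simp: sets_\<nu>)
  also have "\<dots> \<le> (\<Sum>k\<le>n. measure (\<nu> n) (pball (x k) (r k)))"
    by (intro measure_UNION_le) (auto simp: sets_\<nu>)
  also have "\<dots> \<le> (\<Sum>k\<le>n. 2 * C * r k powr s)"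
    using spr[of n] x_space r_pos by (intro sum_mono) (auto simp: spread_def)
  also have "\<dots> = 2 * C * ((\<Sum>k\<le>n. g (U k)) + \<epsilon> * (\<Sum>k\<le>n. (1 / 2) ^ Suc k))"
    unfolding rs by (simp only: sum.distrib sum_distrib_left distrib_left)
  also have "\<dots> \<le> 2 * C * (\<epsilon> + \<epsilon> * 1)"
  proof (intro mult_left_mono add_mono)
    have "ennreal (\<Sum>k\<le>n. g (U k)) = (\<Sum>k\<le>n. ennreal (g (U k)))"
      using g by (intro sum_ennreal[symmetric]) auto
    also have "\<dots> \<le> (\<Sum>k. ennreal (g (U k)))" by (intro sum_le_suminf) auto
    also note U(4)
    finally show "(\<Sum>k\<le>n. g (U k)) \<le> \<epsilon>" using \<epsilon> by (simp add: ennreal_less_iff g sum_nonneg)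
    have "(\<Sum>k\<le>n. (1 / 2 :: real) ^ Suc k) \<le> 1"
      using sum_le_suminf[of "\<lambda>k. (1 / 2 :: real) ^ Suc k" "{..n}"] power_half_series
      by (simp add: sums_iff)
    then show "(\<Sum>k\<le>n. (1 / 2) ^ Suc k) \<le> (1::real)" .
  qed (use start \<epsilon> in auto)
  also have "\<dots> = c / 2" using start by (simp add: \<epsilon>_def)
  finally show False using c by simp
qed

section \<open>The starting mass and the dimension of the limsup set\<close>

text \<open>Makes every s below the dimensional number admissible for the starting mass; the scale A
  = 1 is an arbitrary choice.\<close>

lemma dimnum_le_sum: "dimnum d \<delta> \<kappa> a t \<le> (\<Sum>i<d. \<delta> i)"
proof -
  have "dimnum d \<delta> \<kappa> a t \<le> (\<Sum>k<d. local_exponent (\<delta> k) \<kappa> (a k) (t k) 1)"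
    using d_pos kappa delta_pos a_pos t_pos by (intro dimnum_le_sum_local_exponent) auto
  also have "\<dots> \<le> (\<Sum>i<d. \<delta> i)"
    using kappa delta_pos a_pos t_pos by (intro sum_mono local_exponent_le) auto
  finally show ?thesis .
qed

text \<open>The constant has two sources: regularity gives \<open>K ^ d\<close> for r \<le> r0, and
  for larger r the mass is at most 1 = r0^(-s) * r0^s.\<close>

lemma spread_open_box:
  assumes U: "\<And>i. i < d \<Longrightarrow> openin (mtopology_of (M i)) (U i)" and s: "0 < s" "s \<le> (\<Sum>i<d. \<delta> i)"
  shows "spread s (K ^ d + r0 powr (- s)) (density Pm (indicator (PiE {..<d} U))) (PiE {..<d} U)"
proof -
  define V where "V = PiE {..<d} U"
  have V: "approx_inside V" "V \<in> sets Pm"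
    using U approx_inside_box approx_inside_sets unfolding V_def by blast+
  have em: "emeasure (density Pm (indicator V)) A = emeasure Pm (V \<inter> A)" if "A \<in> sets Pm" for A
    using V(2) that by (rule emeasure_restricted)
  have me: "measure (density Pm (indicator V)) A = measure Pm (V \<inter> A)" if "A \<in> sets Pm" for A
    unfolding measure_def em[OF that] ..
  have fin: "finite_measure (density Pm (indicator V))"
    by (intro finite_measureI) (simp add: em)
  have "measure Pm (V \<inter> pball x r) \<le> (K ^ d + r0 powr (- s)) * r powr s"
    if x: "x \<in> space Pm" and r: "r > 0" for x r
  proof (cases "r \<le> r0")
    case True
    have "measure Pm (V \<inter> pball x r) \<le> measure Pm (pball x r)"
      by (intro P.finite_measure_mono) auto
    also have "\<dots> = (\<Prod>i<d. measure (m i) (mball_of (M i) (x i) r))"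
      unfolding pball_def by (rule P.prob_times) auto
    also have "\<dots> \<le> (\<Prod>i<d. K * r powr \<delta> i)"
      using x r True by (intro prod_mono conjI ball_upper) (auto simp: space_Pm PiE_iff)
    also have "\<dots> = K ^ d * r powr (\<Sum>i<d. \<delta> i)"
      using r by (simp add: prod.distrib powr_sum)
    also have "\<dots> \<le> K ^ d * r powr s"
      using True r r0 s K_ge by (intro mult_left_mono powr_mono') auto
    also have "\<dots> \<le> (K ^ d + r0 powr (- s)) * r powr s" by (intro mult_right_mono) auto
    finally show ?thesis .
  next
    case False
    have "measure Pm (V \<inter> pball x r) \<le> 1" by simp
    also have "1 = r0 powr (- s) * r0 powr s" using r0 by (simp flip: powr_add)
    also have "\<dots> \<le> r0 powr (- s) * r powr s"
      using False r0 s by (intro mult_left_mono powr_mono2) auto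
    also have "\<dots> \<le> (K ^ d + r0 powr (- s)) * r powr s" using K_ge by (intro mult_right_mono) auto
    finally show ?thesis .
  qed
  moreover have "measure Pm (V \<inter> A) \<le> 1 * measure Pm A" if "A \<in> sets Pm" for A
    using that by (auto intro: P.finite_measure_mono)
  moreover have "V \<inter> (space Pm - V) = {}" by blast
  ultimately show ?thesis
    unfolding V_def[symmetric] spread_def using fin V me
    by (intro conjI exI[of _ 1] ballI allI impI) auto
qed

text \<open>Since compactness is available only locally, the construction starts in a product of
  nonempty open sets, each inside a compact set. This product has positive measure because every
  open set contains balls.\<close>

lemma hausdorff_dim_limsup_set_ge:
  assumes loc: "\<And>i. locally_compact_space (mtopology_of (M i))"
  shows "ereal (dimnum d \<delta> \<kappa> a t)
    \<le> hausdorff_dim (PiE {..<d} (\<lambda>i. mspace (M i))) (prod_dist d M) limsup_set"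
proof -
  have "\<exists>U K x. openin (mtopology_of (M i)) U \<and> compactin (mtopology_of (M i)) K \<and> x \<in> U \<and> U \<subseteq> K" for i
  proof -
    obtain x where "x \<in> mspace (M i)" using prob_space.not_empty[OF prob, of i] by (auto simp: space_m)
    then show ?thesis using loc[of i] by (fastforce simp: locally_compact_space_def)
  qed
  then obtain U B x where U: "\<And>i. openin (mtopology_of (M i)) (U i)"
    "\<And>i. compactin (mtopology_of (M i)) (B i)" "\<And>i. x i \<in> U i" "\<And>i. U i \<subseteq> B i"
    by metis
  have "measure (m i) (U i) > 0" for i
  proof -
    obtain r where r: "r > 0" "mball_of (M i) (x i) r \<subseteq> U i" and xi: "x i \<in> mspace (M i)"
      using U(1,3)[of i] unfolding openin_mtopology_of by blast
    have "0 < (min r r0) powr \<delta> i" using r r0 by simp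
    also have "\<dots> \<le> K * measure (m i) (mball_of (M i) (x i) (min r r0))"
      using r r0 xi by (intro ball_lower) auto
    also have "\<dots> \<le> K * measure (m i) (U i)"
      using K_ge r(2) mball_of_mono[of "min r r0" r "M i" "x i"] open_sets[OF U(1)[of i]]
      by (intro mult_left_mono finite_measure.finite_measure_mono[OF finite_measure_m]) auto
    finally show ?thesis using K_ge by (simp add: zero_less_mult_iff)
  qed
  then have pos: "measure Pm (PiE {..<d} U) > 0"
    using open_sets[OF U(1)] by (subst P.prob_times) (auto intro!: prod_pos)
  have V: "PiE {..<d} U \<in> sets Pm" using open_sets[OF U(1)] by (intro sets_PiM_I_finite) auto
  have "dimnum d \<delta> \<kappa> a t \<le> s"
    if "s > 0" "hausdorff_measure (PiE {..<d} (\<lambda>i. mspace (M i))) (prod_dist d M) s limsup_set = 0" for s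
  proof (rule ccontr)
    assume "\<not> dimnum d \<delta> \<kappa> a t \<le> s"
    then have s: "0 < s" "s < dimnum d \<delta> \<kappa> a t" using that by auto
    have "hausdorff_measure (PiE {..<d} (\<lambda>i. mspace (M i))) (prod_dist d M) s limsup_set \<noteq> 0"
    proof (rule hausdorff_measure_limsup_set_pos[OF spread_open_box[where U = U]])
      show "K ^ d + r0 powr (- s) > 0" using K_ge by (intro add_pos_nonneg) auto
      show "measure (density Pm (indicator (PiE {..<d} U))) (PiE {..<d} U) > 0"
        using pos V by (simp add: measure_def emeasure_restricted)
      show "PiE {..<d} U \<subseteq> PiE {..<d} B" using U(4) by (intro PiE_mono)
    qed (use U s dimnum_le_sum in auto)
    then show False using that by blast
  qed
  then show ?thesis unfolding hausdorff_dim_def by (intro Inf_greatest) auto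
qed

end

subsection \<open>The lower bound\<close>

text \<open>Both regularity hypotheses on one factor with a single constant, in a form monotone in
  \<open>K\<close> and \<open>r0\<close>, so that the constants of the d factors can be
  merged.\<close>

definition regular_at ::
  "real \<Rightarrow> real \<Rightarrow> 'a metric \<Rightarrow> 'a measure \<Rightarrow> real \<Rightarrow> real \<Rightarrow> 'j set \<Rightarrow> ('j \<Rightarrow> 'a set) \<Rightarrow> bool" where
  "regular_at K r0 X \<mu> \<delta> \<kappa> J R \<longleftrightarrow>
     (\<forall>x\<in>mspace X. \<forall>r. 0 < r \<longrightarrow> r \<le> r0 \<longrightarrow>
        r powr \<delta> \<le> K * measure \<mu> (mball_of X x r) \<and> measure \<mu> (mball_of X x r) \<le> K * r powr \<delta>) \<and>
     (\<forall>\<alpha>\<in>J. \<forall>x\<in>R \<alpha>. \<forall>\<epsilon> r. 0 < \<epsilon> \<longrightarrow> \<epsilon> < r \<longrightarrow> r \<le> r0 \<longrightarrow>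
        r powr (\<delta> * \<kappa>) * \<epsilon> powr (\<delta> * (1 - \<kappa>)) \<le> K * measure \<mu> (mball_of X x r \<inter> nbhd X (R \<alpha>) \<epsilon>) \<and>
        measure \<mu> (mball_of X x r \<inter> nbhd X (R \<alpha>) \<epsilon>) \<le> K * (r powr (\<delta> * \<kappa>) * \<epsilon> powr (\<delta> * (1 - \<kappa>))))"

lemma regular_at_mono:
  assumes reg: "regular_at K r0 X \<mu> \<delta> \<kappa> J R" and le: "K \<le> K'" "r0' \<le> r0"
  shows "regular_at K' r0' X \<mu> \<delta> \<kappa> J R"
proof -
  have *: "x \<le> K' * y" if "x \<le> K * y" "y \<ge> 0" for x y :: real
    using that mult_right_mono[OF le(1) that(2)] by linarith
  show ?thesis
    using reg le(2) unfolding regular_at_def by (auto intro!: *)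
qed

lemma ex_regular_at:
  assumes "ahlfors_regular X \<mu> \<delta>" "kappa_scaling X \<mu> \<delta> J R \<kappa>"
  shows "\<exists>K r0. K \<ge> 1 \<and> 0 < r0 \<and> r0 < 1 \<and> regular_at K r0 X \<mu> \<delta> \<kappa> J R"
proof -
  obtain c C ra where A: "c > 0" "C > 0" "ra > 0" "\<And>x r. x \<in> mspace X \<Longrightarrow> 0 < r \<Longrightarrow> r \<le> ra \<Longrightarrow>
      c * r powr \<delta> \<le> measure \<mu> (mball_of X x r) \<and> measure \<mu> (mball_of X x r) \<le> C * r powr \<delta>"
    using assms(1) unfolding ahlfors_regular_def by blast
  obtain c2 c3 r1 where B: "c2 > 0" "c3 > 0" "r1 > 0" "\<forall>\<alpha>\<in>J. \<forall>x\<in>R \<alpha>. \<forall>\<epsilon> r. 0 < \<epsilon> \<and> \<epsilon> < r \<and> r \<le> r1 \<longrightarrow>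
      c2 * r powr (\<delta> * \<kappa>) * \<epsilon> powr (\<delta> * (1 - \<kappa>)) \<le> measure \<mu> (mball_of X x r \<inter> nbhd X (R \<alpha>) \<epsilon>) \<and>
      measure \<mu> (mball_of X x r \<inter> nbhd X (R \<alpha>) \<epsilon>) \<le> c3 * r powr (\<delta> * \<kappa>) * \<epsilon> powr (\<delta> * (1 - \<kappa>))"
    using assms(2) unfolding kappa_scaling_def by (elim exE conjE) (rule that)
  \<comment> \<open>Dominates every constant at once, with reciprocals for the lower bounds; the 1 /
    2 below forces r0 < 1.\<close>
  define K where "K = 1 + 1 / c + C + 1 / c2 + c3"
  define r0 where "r0 = min (1 / 2) (min ra r1)"
  have r0: "0 < r0" "r0 < 1" "r0 \<le> ra" "r0 \<le> r1" using A(3) B(3) by (auto simp: r0_def)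
  have K: "K \<ge> 1" "1 / c \<le> K" "C \<le> K" "1 / c2 \<le> K" "c3 \<le> K"
    using A B by (auto simp: K_def)
  have lower: "y \<le> K * x" if "b * y \<le> x" "b > 0" "1 / b \<le> K" "x \<ge> 0" for x y b :: real
  proof -
    have "y \<le> 1 / b * x" using that by (simp add: field_simps)
    also have "\<dots> \<le> K * x" using that by (intro mult_right_mono)
    finally show ?thesis .
  qed
  have upper: "x \<le> K * y" if "x \<le> b * y" "b \<le> K" "y \<ge> 0" for x y b :: real
    using that mult_right_mono[OF that(2,3)] by linarith
  have "regular_at K r0 X \<mu> \<delta> \<kappa> J R"
    unfolding regular_at_def
  proof (intro conjI ballI allI impI)
    fix x r assume "x \<in> mspace X" "0 < r" "r \<le> r0"
    with A(4)[of x r] r0 have *: "c * r powr \<delta> \<le> measure \<mu> (mball_of X x r)"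
      "measure \<mu> (mball_of X x r) \<le> C * r powr \<delta>" by auto
    show "r powr \<delta> \<le> K * measure \<mu> (mball_of X x r)"
      by (rule lower[OF *(1) A(1) K(2)]) simp
    show "measure \<mu> (mball_of X x r) \<le> K * r powr \<delta>"
      by (rule upper[OF *(2) K(3)]) simp
  next
    fix \<alpha> x \<epsilon> r assume "\<alpha> \<in> J" "x \<in> R \<alpha>" "0 < \<epsilon>" "\<epsilon> < r" "r \<le> r0"
    with B(4)[rule_format, of \<alpha> x \<epsilon> r] r0 have *:
      "c2 * (r powr (\<delta> * \<kappa>) * \<epsilon> powr (\<delta> * (1 - \<kappa>))) \<le> measure \<mu> (mball_of X x r \<inter> nbhd X (R \<alpha>) \<epsilon>)"
      "measure \<mu> (mball_of X x r \<inter> nbhd X (R \<alpha>) \<epsilon>) \<le> c3 * (r powr (\<delta> * \<kappa>) * \<epsilon> powr (\<delta> * (1 - \<kappa>)))"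
      by (auto simp: mult.assoc)
    show "r powr (\<delta> * \<kappa>) * \<epsilon> powr (\<delta> * (1 - \<kappa>)) \<le> K * measure \<mu> (mball_of X x r \<inter> nbhd X (R \<alpha>) \<epsilon>)"
      by (rule lower[OF *(1) B(1) K(4)]) simp
    show "measure \<mu> (mball_of X x r \<inter> nbhd X (R \<alpha>) \<epsilon>) \<le> K * (r powr (\<delta> * \<kappa>) * \<epsilon> powr (\<delta> * (1 - \<kappa>)))"
      by (rule upper[OF *(2) K(5)]) simp
  qed
  then show ?thesis using K(1) r0 by blast
qed

theorem mainTheorem4:
  fixes d :: nat and M :: "nat \<Rightarrow> 'a metric" and m :: "nat \<Rightarrow> 'a measure"
    and \<delta> :: "nat \<Rightarrow> real" and \<kappa> :: real
    and J :: "'j set" and \<beta> :: "'j \<Rightarrow> real" and \<rho> :: "real \<Rightarrow> real"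
    and R :: "'j \<Rightarrow> nat \<Rightarrow> 'a set" and a t :: "nat \<Rightarrow> real"
  assumes d_pos: "d \<ge> 1"
    and bounded: "\<And>i. i < d \<Longrightarrow> Metric_space.mbounded (mspace (M i)) (mdist (M i)) (mspace (M i))"
    and loc_compact: "\<And>i. i < d \<Longrightarrow> locally_compact_space (mtopology_of (M i))"
    and prob: "\<And>i. i < d \<Longrightarrow> prob_space (m i)"
    and space_m: "\<And>i. i < d \<Longrightarrow> space (m i) = mspace (M i)"
    and borel_m: "\<And>i. i < d \<Longrightarrow> sets (m i) = borel_sets_of (M i)"
    and delta_pos: "\<And>i. i < d \<Longrightarrow> \<delta> i > 0"
    and ahlfors: "\<And>i. i < d \<Longrightarrow> ahlfors_regular (M i) (m i) (\<delta> i)"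
    and J_countable: "countable J" and J_infinite: "infinite J"
    and beta_pos: "\<And>\<alpha>. \<alpha> \<in> J \<Longrightarrow> \<beta> \<alpha> > 0"
    and beta_fin: "\<And>B. B > 1 \<Longrightarrow> finite {\<alpha>\<in>J. \<beta> \<alpha> < B}"
    and rho_pos: "\<And>u. u > 0 \<Longrightarrow> \<rho> u > 0"
    and rho_antimono: "\<And>u v. 0 < u \<Longrightarrow> u \<le> v \<Longrightarrow> \<rho> v \<le> \<rho> u"
    and rho_lim: "(\<rho> \<longlongrightarrow> 0) at_top"
    and R_sub: "\<And>\<alpha> i. \<alpha> \<in> J \<Longrightarrow> i < d \<Longrightarrow> R \<alpha> i \<subseteq> mspace (M i)"
    and kappa: "0 \<le> \<kappa>" "\<kappa> < 1"
    and scaling: "\<And>i. i < d \<Longrightarrow> kappa_scaling (M i) (m i) (\<delta> i) J (\<lambda>\<alpha>. R \<alpha> i) \<kappa>"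
    and a_pos: "\<And>i. i < d \<Longrightarrow> a i > 0"
    and full: "AE x in PiM {..<d} m.
                 infinite {\<alpha>\<in>J. \<forall>i<d. x i \<in> nbhd (M i) (R \<alpha> i) (\<rho> (\<beta> \<alpha>) powr a i)}"
    and t_pos: "\<And>i. i < d \<Longrightarrow> t i > 0"
  shows "hausdorff_dim (PiE {..<d} (\<lambda>i. mspace (M i))) (prod_dist d M)
            (Wset d M J R \<beta> \<rho> a t)
         \<ge> ereal (dimnum d \<delta> \<kappa> a t)"
proof -
  \<comment> \<open>Redirecting the indices \<open>i \<ge> d\<close> to \<open>0\<close> makes every hypothesis hold for all \<open>i\<close>, as the locale requires.\<close>
  define e where "e i = (if i < d then i else 0)" for i
  have ed: "e i < d" and e_id: "i < d \<Longrightarrow> e i = i" for i using d_pos by (auto simp: e_def)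
  have "\<exists>K r0. K \<ge> 1 \<and> 0 < r0 \<and> r0 < 1 \<and> regular_at K r0 (M i) (m i) (\<delta> i) \<kappa> J (\<lambda>\<alpha>. R \<alpha> i)"
    if "i < d" for i
    using ex_regular_at[OF ahlfors[OF that] scaling[OF that]] by blast
  then obtain Kf rf where Kf: "\<And>i. i < d \<Longrightarrow> Kf i \<ge> 1" and rf: "\<And>i. i < d \<Longrightarrow> 0 < rf i \<and> rf i < 1"
    and reg: "\<And>i. i < d \<Longrightarrow> regular_at (Kf i) (rf i) (M i) (m i) (\<delta> i) \<kappa> J (\<lambda>\<alpha>. R \<alpha> i)"
    by metis
  define K r0 where "K = Max (Kf ` {..<d})" and "r0 = Min (rf ` {..<d})"
  have ne: "{..<d} \<noteq> {}" using d_pos by (simp add: lessThan_empty_iff)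
  have K: "Kf i \<le> K" and r: "r0 \<le> rf i" if "i < d" for i
    using that unfolding K_def r0_def by (auto intro!: Max_ge Min_le)
  have K1: "K \<ge> 1" using K[OF ed[of 0]] Kf[OF ed[of 0]] by linarith
  have r0: "0 < r0" "r0 < 1"
    using ne rf r[OF ed[of 0]] rf[OF ed[of 0]] by (auto simp: r0_def Min_gr_iff)
  have reg': "regular_at K r0 (M (e i)) (m (e i)) (\<delta> (e i)) \<kappa> J (\<lambda>\<alpha>. R \<alpha> (e i))" for i
    using regular_at_mono[OF reg[OF ed] K[OF ed] r[OF ed]] .
  have PiM_e: "PiM {..<d} (\<lambda>i. m (e i)) = PiM {..<d} m" by (rule PiM_cong) (simp_all add: e_id)
  interpret resonant_system d "\<lambda>i. M (e i)" "\<lambda>i. m (e i)" "\<lambda>i. \<delta> (e i)" \<kappa> J "\<lambda>\<alpha> i. R \<alpha> (e i)"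
    "\<lambda>\<alpha>. \<rho> (\<beta> \<alpha>)" "\<lambda>i. a (e i)" "\<lambda>i. t (e i)" K r0
  proof (rule resonant_system.intro)
    show "finite {\<alpha>\<in>J. \<tau> \<le> \<rho> (\<beta> \<alpha>)}" if \<tau>: "\<tau> > 0" for \<tau>
    proof -
      have "eventually (\<lambda>u. \<rho> u < \<tau>) at_top" using rho_lim \<tau> by (rule order_tendstoD)
      then obtain B where B: "\<And>u. u \<ge> B \<Longrightarrow> \<rho> u < \<tau>" by (auto simp: eventually_at_top_linorder)
      \<comment> \<open>The 2 is there because finiteness of {\<beta> < bound} is assumed for bounds
        above 1.\<close>
      have "\<beta> \<alpha> < max B 2" if "\<tau> \<le> \<rho> (\<beta> \<alpha>)" for \<alpha>
        using B[of "\<beta> \<alpha>"] that by force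
      then have "{\<alpha>\<in>J. \<tau> \<le> \<rho> (\<beta> \<alpha>)} \<subseteq> {\<alpha>\<in>J. \<beta> \<alpha> < max B 2}" by blast
      then show ?thesis by (rule finite_subset) (rule beta_fin, simp)
    qed
    have "(\<forall>i<d. x i \<in> nbhd (M (e i)) (R \<alpha> (e i)) (\<rho> (\<beta> \<alpha>) powr a (e i)))
        \<longleftrightarrow> (\<forall>i<d. x i \<in> nbhd (M i) (R \<alpha> i) (\<rho> (\<beta> \<alpha>) powr a i))" for x \<alpha>
      by (auto simp: e_id)
    then show "AE x in PiM {..<d} (\<lambda>i. m (e i)).
        infinite {\<alpha>\<in>J. \<forall>i<d. x i \<in> nbhd (M (e i)) (R \<alpha> (e i)) (\<rho> (\<beta> \<alpha>) powr a (e i))}"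
      using full unfolding PiM_e by simp
  next
    fix i x r assume "x \<in> mspace (M (e i))" "0 < r" "r \<le> r0"
    then show "r powr \<delta> (e i) \<le> K * measure (m (e i)) (mball_of (M (e i)) x r)"
      and "measure (m (e i)) (mball_of (M (e i)) x r) \<le> K * r powr \<delta> (e i)"
      using reg'[of i] unfolding regular_at_def by blast+
  next
    fix i \<alpha> x \<epsilon> r assume "\<alpha> \<in> J" "x \<in> R \<alpha> (e i)" "0 < \<epsilon>" "\<epsilon> < r" "r \<le> r0"
    then show "r powr (\<delta> (e i) * \<kappa>) * \<epsilon> powr (\<delta> (e i) * (1 - \<kappa>))
        \<le> K * measure (m (e i)) (mball_of (M (e i)) x r \<inter> nbhd (M (e i)) (R \<alpha> (e i)) \<epsilon>)"
      and "measure (m (e i)) (mball_of (M (e i)) x r \<inter> nbhd (M (e i)) (R \<alpha> (e i)) \<epsilon>)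
        \<le> K * (r powr (\<delta> (e i) * \<kappa>) * \<epsilon> powr (\<delta> (e i) * (1 - \<kappa>)))"
      using reg'[of i] unfolding regular_at_def by blast+
  qed (assumption | rule ed d_pos prob space_m borel_m delta_pos kappa a_pos t_pos K1 r0 R_sub
      J_countable J_infinite rho_pos beta_pos)+
  have "Wset d M J R \<beta> \<rho> a t = limsup_set"
  proof -
    have "(\<forall>i<d. x i \<in> nbhd (M (e i)) (R \<alpha> (e i)) (\<rho> (\<beta> \<alpha>) powr (a (e i) + t (e i))))
        \<longleftrightarrow> (\<forall>i<d. x i \<in> nbhd (M i) (R \<alpha> i) (\<rho> (\<beta> \<alpha>) powr (a i + t i)))" for x \<alpha>
      by (auto simp: e_id)
    moreover have "PiE {..<d} (\<lambda>i. mspace (M (e i))) = PiE {..<d} (\<lambda>i. mspace (M i))"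
      by (intro PiE_cong) (simp add: e_id)
    ultimately show ?thesis by (simp add: Wset_def limsup_set_def)
  qed
  moreover have "PiE {..<d} (\<lambda>i. mspace (M (e i))) = PiE {..<d} (\<lambda>i. mspace (M i))"
    by (intro PiE_cong) (simp add: e_id)
  moreover have "Defs.prod_dist d (\<lambda>i. M (e i)) = Defs.prod_dist d M"
    unfolding prod_dist_def by (simp add: e_id cong: image_cong_simp)
  moreover have "dimnum d (\<lambda>i. \<delta> (e i)) \<kappa> (\<lambda>i. a (e i)) (\<lambda>i. t (e i)) = dimnum d \<delta> \<kappa> a t"
    unfolding dimnum_eq_Min_local_exponent by (simp add: e_id cong: image_cong_simp)
  ultimately show ?thesis
    using hausdorff_dim_limsup_set_ge loc_compact ed by simp
qed

end
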